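(* Let $p\ge1$ be an integer. Thompson's group $F(p+1)$ contains seesaw words of arbitrarily large swing with respect to $x_0\in X=\{x_0,\dots,x_p\}$; that is, for every $K\in\mathbb{N}$ there exist $k\ge K$ and an element $w\in F(p+1)$ which is a seesaw word with swing $k$ with respect to $x_0$ in the generating set $X$.
   Context: For an integer $p\ge1$, $F(p+1)$ is the group of piecewise-linear orientation-preserving homeomorphisms of $[0,1]$ with finitely many breakpoints, all in $\mathbb{Z}[\frac1{p+1}]$, and with slopes in the multiplicative group generated by $p+1$; the product is $fg=f\circ g$. Standard finite generating set $X=\{x_0,\dots,x_p\}$: for $0\le i\le p-1$, in the domain divide $[0,1]$ into $p+1$ equal intervals and divide the last of these again into $p+1$ equal intervals; in the range divide $[0,1]$ into $p+1$ equal intervals and divide the $(i+1)$-st (from the left) of these again into $p+1$ equal intervals; $x_i$ maps the $j$-th domain interval affinely and increasingly onto the $j$-th range interval, for each $j=1,\dots,2p+1$. The generator $x_p$ is the identity on $[0,\frac p{p+1}]$ and $x_p(t)=\frac{p+x_0((p+1)t-p)}{p+1}$ on $[\frac p{p+1},1]$. $|w|$ denotes word length with respect to $X$. Seesaw word: an element $w$ of a group with generating set $X$ is a seesaw word with swing $k\in\mathbb{N}$ ($k\geq 1$) with respect to $g\in X$ if (1) $|wg^l|=|w|-|l|$ for all integers $l$ with $0<|l|\le k$, and (2) $|wg^lh|\ge|wg^l|$ for all $h\in X\cup X^{-1}$ with $h\ne g^{\pm1}$ and all integers $l$ with $0\le|l|<k$. Equivalently, every geodesic representative of $w$ ends in $g^k$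 or $g^{-k}$, and there is at least one geodesic representative of each type. *)

theory Defs
  imports "HOL-Analysis.Analysis" "HOL-Algebra.Bij"
begin

section \<open>The groups F(n)\<close>

definition nadic :: "nat \<Rightarrow> real set" where
  "nadic n = {of_int a / real n ^ k | a k. True}"

text \<open>The finite set \<open>S\<close> contains all breakpoints of \<open>f\<close>; it may contain further points of
  \<open>\<int>[1/n]\<close>, which does not affect the resulting class of functions.\<close>

definition nadic_pl :: "nat \<Rightarrow> (real \<Rightarrow> real) \<Rightarrow> bool" where
  "nadic_pl n f \<longleftrightarrow>
    (\<exists>S. finite S \<and> S \<subseteq> nadic n \<and>
      (\<forall>a b. 0 \<le> a \<and> a < b \<and> b \<le> 1 \<and> {a<..<b} \<inter> S = {} \<longrightarrow>
        (\<exists>(k::int) c. \<forall>t\<in>{a..b}. f t = real n powi k * t + c)))"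

text \<open>As in \<^const>\<open>Bij\<close>, maps of \<open>[0,1]\<close> are represented by extensional functions, so that
  equality of group elements is equality of functions.\<close>

definition thompson_carrier :: "nat \<Rightarrow> (real \<Rightarrow> real) set" where
  "thompson_carrier n =
    {f \<in> extensional {0..1}.
       (\<exists>g. homeomorphism {0..1} {0..1} f g) \<and> strict_mono_on {0..1} f \<and> nadic_pl n f}"

text \<open>The multiplication inherited from \<^const>\<open>BijGroup\<close> is \<open>f g = f \<circ> g\<close>.\<close>

definition thompson_F :: "nat \<Rightarrow> (real \<Rightarrow> real) monoid" where
  "thompson_F n = (BijGroup {0..1})\<lparr>carrier := thompson_carrier n\<rparr>"


section \<open>The standard generators of F(p+1)\<close>

text \<open>Divide \<open>[0,1]\<close> into \<open>p + 1\<close> equal intervals and divide the \<open>(m+1)\<close>-st of these again into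
  \<open>p + 1\<close> equal intervals.  The endpoints of the resulting \<open>2p + 1\<close> intervals are
  \<open>subdiv p m 0 < \<dots> < subdiv p m (2p+1)\<close>.\<close>

definition subdiv :: "nat \<Rightarrow> nat \<Rightarrow> nat \<Rightarrow> real" where
  "subdiv p m j =
    (if j \<le> m then real j / real (p + 1)
     else if j \<le> m + p + 1 then real m / real (p + 1) + real (j - m) / real (p + 1) ^ 2
     else real (j - p) / real (p + 1))"

text \<open>The map sending \<open>[subdiv p p j, subdiv p p (j+1)]\<close> affinely and increasingly onto
  \<open>[subdiv p i j, subdiv p i (j+1)]\<close> for all \<open>j < 2p + 1\<close>.\<close>

definition subdiv_map :: "nat \<Rightarrow> nat \<Rightarrow> real \<Rightarrow> real" where
  "subdiv_map p i = (\<lambda>t\<in>{0..1}.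
     let j = (LEAST j. t \<le> subdiv p p (Suc j))
     in subdiv p i j + (t - subdiv p p j) / (subdiv p p (Suc j) - subdiv p p j)
                        * (subdiv p i (Suc j) - subdiv p i j))"

definition thompson_gen :: "nat \<Rightarrow> nat \<Rightarrow> real \<Rightarrow> real" where
  "thompson_gen p i =
    (if i < p then subdiv_map p i
     else (\<lambda>t\<in>{0..1}.
       if t \<le> real p / real (p + 1) then t
       else (real p + subdiv_map p 0 (real (p + 1) * t - real p)) / real (p + 1)))"

definition thompson_gens :: "nat \<Rightarrow> (real \<Rightarrow> real) set" where
  "thompson_gens p = thompson_gen p ` {0..p}"


section \<open>Word length and seesaw words\<close>

definition word_length :: "('a, 'b) monoid_scheme \<Rightarrow> 'a set \<Rightarrow> 'a \<Rightarrow> nat" where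
  "word_length G X w =
    (LEAST n. \<exists>hs. set hs \<subseteq> X \<union> m_inv G ` X \<and> length hs = n \<and> foldr (mult G) hs (one G) = w)"

text \<open>Lengths are compared in \<^typ>\<open>int\<close>, so the subtraction is not truncated.  An element outside the
  subgroup generated by \<open>X\<close> has an unspecified length, constant on its coset; the first length
  condition then fails, so such an element is never a seesaw word.\<close>

definition seesaw_word :: "('a, 'b) monoid_scheme \<Rightarrow> 'a set \<Rightarrow> 'a \<Rightarrow> nat \<Rightarrow> 'a \<Rightarrow> bool" where
  "seesaw_word G X g k w \<longleftrightarrow>
    g \<in> X \<and> w \<in> carrier G \<and> k \<ge> 1 \<and>
    (\<forall>l::int. 0 < \<bar>l\<bar> \<and> \<bar>l\<bar> \<le> int k \<longrightarrow>
       int (word_length G X (w \<otimes>\<^bsub>G\<^esub> (g [^]\<^bsub>G\<^esub> l))) = int (word_length G X w) - \<bar>l\<bar>) \<and>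
    (\<forall>h \<in> X \<union> m_inv G ` X. h \<noteq> g \<and> h \<noteq> inv\<^bsub>G\<^esub> g \<longrightarrow>
       (\<forall>l::int. \<bar>l\<bar> < int k \<longrightarrow>
          word_length G X (w \<otimes>\<^bsub>G\<^esub> (g [^]\<^bsub>G\<^esub> l) \<otimes>\<^bsub>G\<^esub> h)
            \<ge> word_length G X (w \<otimes>\<^bsub>G\<^esub> (g [^]\<^bsub>G\<^esub> l))))"


section \<open>F(n) is a group, and it contains the standard generators\<close>

lemma nadic_add: "x \<in> nadic n \<Longrightarrow> y \<in> nadic n \<Longrightarrow> n > 0 \<Longrightarrow> x + y \<in> nadic n"
proof -
  assume n: "n > 0" and "x \<in> nadic n" "y \<in> nadic n"
  then obtain a k b l where "x = of_int a / real n ^ k" "y = of_int b / real n ^ l"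
    unfolding nadic_def by blast
  then have "x + y = of_int (a * int n ^ l + b * int n ^ k) / real n ^ (k + l)"
    using n by (simp add: add_frac_eq power_add)
  then show ?thesis unfolding nadic_def by blast
qed

lemma nadic_mult: "x \<in> nadic n \<Longrightarrow> y \<in> nadic n \<Longrightarrow> x * y \<in> nadic n"
proof -
  assume "x \<in> nadic n" "y \<in> nadic n"
  then obtain a k b l where "x = of_int a / real n ^ k" "y = of_int b / real n ^ l"
    unfolding nadic_def by blast
  then have "x * y = of_int (a * b) / real n ^ (k + l)"
    by (simp add: field_simps power_add)
  then show ?thesis unfolding nadic_def by blast
qed

lemma nadic_of_int: "of_int a \<in> nadic n"
  unfolding nadic_def by (rule CollectI, rule exI[of _ a], rule exI[of _ 0]) simp

lemma nadic_diff: "x \<in> nadic n \<Longrightarrow> y \<in> nadic n \<Longrightarrow> n > 0 \<Longrightarrow> x - y \<in> nadic n"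
  using nadic_add[of x n "- 1 * y"] nadic_mult[of "-1" n y] nadic_of_int[of "-1" n] by simp

lemma nadic_powi: "n > 0 \<Longrightarrow> real n powi k \<in> nadic n"
proof (cases "k \<ge> 0")
  case True
  then have "real n powi k = of_int (int n ^ nat k)" by (simp add: power_int_def)
  then show ?thesis by (metis nadic_of_int)
next
  case False
  then have "real n powi k = of_int 1 / real n ^ nat (- k)"
    by (simp add: power_int_def field_simps)
  then show ?thesis unfolding nadic_def by blast
qed

lemma thompson_carrierD:
  assumes "f \<in> thompson_carrier n"
  shows "f \<in> extensional {0..1}" "bij_betw f {0..1} {0..1}" "strict_mono_on {0..1} f"
    "continuous_on {0..1} f" "f 0 = 0" "f 1 = 1" "nadic_pl n f" "f \<in> Bij {0..1}"
proof -
  show ext: "f \<in> extensional {0..1}" and mono: "strict_mono_on {0..1} f" and "nadic_pl n f"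
    using assms unfolding thompson_carrier_def by auto
  show "continuous_on {0..1} f" using assms unfolding thompson_carrier_def homeomorphism_def by auto
  show bij: "bij_betw f {0..1} {0..1}"
    using assms strict_mono_on_imp_inj_on[OF mono]
    unfolding thompson_carrier_def homeomorphism_def bij_betw_def by auto
  then have im: "f ` {0..1} = {0..1}" by (simp add: bij_betw_def)
  then obtain s where s: "s \<in> {0..1}" "f s = 0" by (metis atLeastAtMost_iff imageE order_refl zero_le_one)
  from im obtain r where r: "r \<in> {0..1}" "f r = 1" by (metis atLeastAtMost_iff imageE order_refl zero_le_one)
  have "f 0 \<in> {0..1}" "f 1 \<in> {0..1}" using im by auto
  then show "f 0 = 0" "f 1 = 1"
    using s r strict_mono_on_leD[OF mono, of 0 s] strict_mono_on_leD[OF mono, of r 1] by auto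
  show "f \<in> Bij {0..1}" using ext bij by (simp add: Bij_def)
qed

lemma thompson_carrierI:
  assumes "f \<in> extensional {0..1}" "strict_mono_on {0..1} f" "continuous_on {0..1} f"
    "f 0 = 0" "f 1 = 1" "nadic_pl n f"
  shows "f \<in> thompson_carrier n"
proof -
  have sub: "f x \<in> {0..1}" if "x \<in> {0..1}" for x
    using that assms(4,5) strict_mono_on_leD[OF assms(2), of 0 x] strict_mono_on_leD[OF assms(2), of x 1]
    by auto
  have sup: "y \<in> f ` {0..1}" if "y \<in> {0..1}" for y
    using IVT'[of f 0 y 1] that assms(3-5) by fastforce
  have im: "f ` {0..1} = {0..1}" using sub sup by blast
  have "\<exists>g. homeomorphism {0..1} {0..1} f g"
    using homeomorphism_compact[OF compact_Icc assms(3) im strict_mono_on_imp_inj_on[OF assms(2)]] by blast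
  then show ?thesis using assms unfolding thompson_carrier_def by auto
qed

lemma nadic_plE:
  assumes "nadic_pl n f"
  obtains S where "finite S" "S \<subseteq> nadic n"
    "\<And>a b. \<lbrakk>0 \<le> a; a < b; b \<le> 1; {a<..<b} \<inter> S = {}\<rbrakk> \<Longrightarrow>
        (\<exists>(k::int) c. \<forall>t\<in>{a..b}. f t = real n powi k * t + c)"
proof -
  obtain S where "finite S \<and> S \<subseteq> nadic n \<and>
      (\<forall>a b. 0 \<le> a \<and> a < b \<and> b \<le> 1 \<and> {a<..<b} \<inter> S = {} \<longrightarrow>
        (\<exists>(k::int) c. \<forall>t\<in>{a..b}. f t = real n powi k * t + c))"
    using assms unfolding nadic_pl_def by (elim exE)
  then show ?thesis by (intro that[of S]) simp_all
qed

lemma thompson_carrier_nadic: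
  assumes f: "f \<in> thompson_carrier n" and n: "n > 0"
    and x: "x \<in> nadic n" "x \<in> {0..1}"
  shows "f x \<in> nadic n"
proof -
  obtain S where S: "finite S" "S \<subseteq> nadic n"
    and pl: "\<And>a b. \<lbrakk>0 \<le> a; a < b; b \<le> 1; {a<..<b} \<inter> S = {}\<rbrakk> \<Longrightarrow>
        (\<exists>(k::int) c. \<forall>t\<in>{a..b}. f t = real n powi k * t + c)"
    using nadic_plE[OF thompson_carrierD(7)[OF f]] by metis
  have z: "(0::real) \<in> nadic n" using nadic_of_int[of 0 n] by simp
  show ?thesis using x
  proof (induction "card (S \<inter> {0<..<x})" arbitrary: x rule: less_induct)
    case less
    have step: "f x \<in> nadic n" if s: "0 \<le> s" "s < x" "{s<..<x} \<inter> S = {}" "s \<in> nadic n" "f s \<in> nadic n" for s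
    proof -
      obtain k c where kc: "\<forall>t\<in>{s..x}. f t = real n powi k * t + c"
        using pl[of s x] s less.prems by auto
      then have "f x = real n powi k * x + c" "f s = real n powi k * s + c" using s(2) by auto
      then have "f x = f s + real n powi k * (x - s)" by (simp only: algebra_simps)
      then show ?thesis using s n less.prems by (auto intro!: nadic_add nadic_mult nadic_powi nadic_diff)
    qed
    show ?case
    proof (cases "S \<inter> {0<..<x} = {}")
      case True
      then show ?thesis using step[of 0] less.prems z thompson_carrierD(5)[OF f]
        by (cases "x = 0") auto
    next
      case False
      define s where "s = Max (S \<inter> {0<..<x})"
      have sm: "s \<in> S \<inter> {0<..<x}" using False S(1) unfolding s_def by (intro Max_in) auto
      have mx: "y \<le> s" if "y \<in> S \<inter> {0<..<x}" for y
        using that S(1) unfolding s_def by (intro Max_ge) auto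
      have "S \<inter> {0<..<s} \<subset> S \<inter> {0<..<x}" using sm by auto
      then have "card (S \<inter> {0<..<s}) < card (S \<inter> {0<..<x})" using S(1) by (intro psubset_card_mono) auto
      then have "f s \<in> nadic n" using less.hyps sm S(2) less.prems by auto
      moreover have "{s<..<x} \<inter> S = {}" using mx sm by force
      ultimately show ?thesis using step[of s] sm S(2) by auto
    qed
  qed
qed

lemma thompson_carrier_inv:
  assumes f: "f \<in> thompson_carrier n" and n: "n > 0"
  shows "restrict (inv_into {0..1} f) {0..1} \<in> thompson_carrier n" (is "?g \<in> _")
proof -
  note D = thompson_carrierD[OF f]
  have g: "?g y \<in> {0..1}" "f (?g y) = y" if "y \<in> {0..1}" for y
    using that bij_betw_apply[OF bij_betw_inv_into[OF D(2)] that] bij_betw_inv_into_right[OF D(2) that]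
    by auto
  have gf: "?g (f x) = x" "f x \<in> {0..1}" if "x \<in> {0..1}" for x
  proof -
    show "f x \<in> {0..1}" using D(2) that by (auto simp: bij_betw_def)
    then show "?g (f x) = x" using D(2) that by (simp add: bij_betw_def)
  qed
  have mono: "strict_mono_on {0..1} ?g"
  proof (rule strict_mono_onI)
    fix r s :: real assume rs: "r \<in> {0..1}" "s \<in> {0..1}" "r < s"
    show "?g r < ?g s"
    proof (rule ccontr)
      assume "\<not> ?g r < ?g s"
      then have "f (?g s) \<le> f (?g r)"
        using strict_mono_on_leD[OF D(3), of "?g s" "?g r"] g(1)[OF rs(1)] g(1)[OF rs(2)] by linarith
      then show False using g(2)[OF rs(1)] g(2)[OF rs(2)] rs(3) by linarith
    qed
  qed
  obtain h where h: "homeomorphism {0..1} {0..1} f h" using f unfolding thompson_carrier_def by auto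
  have gh: "?g y = h y" if "y \<in> {0..1}" for y
    using h that gf(1)[of "h y"] unfolding homeomorphism_def by fastforce
  have "continuous_on {0..1} h" using h by (simp add: homeomorphism_def)
  then have cont: "continuous_on {0..1} ?g" using gh continuous_on_cong by metis
  obtain S where S: "finite S" "S \<subseteq> nadic n"
    and pl: "\<And>a b. \<lbrakk>0 \<le> a; a < b; b \<le> 1; {a<..<b} \<inter> S = {}\<rbrakk> \<Longrightarrow>
        (\<exists>(k::int) c. \<forall>t\<in>{a..b}. f t = real n powi k * t + c)"
    using nadic_plE[OF D(7)] by metis
  have npl: "nadic_pl n ?g" unfolding nadic_pl_def
  proof (intro exI[of _ "f ` (S \<inter> {0..1})"] conjI allI impI)
    show "finite (f ` (S \<inter> {0..1}))" using S by auto
    show "f ` (S \<inter> {0..1}) \<subseteq> nadic n" using S thompson_carrier_nadic[OF f n] by auto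
    fix a b :: real assume ab: "0 \<le> a \<and> a < b \<and> b \<le> 1 \<and> {a<..<b} \<inter> f ` (S \<inter> {0..1}) = {}"
    have in1: "a \<in> {0..1}" "b \<in> {0..1}" using ab by auto
    have lt: "?g a < ?g b" using strict_mono_onD[OF mono] ab in1 by auto
    have "{?g a<..<?g b} \<inter> S = {}"
    proof (rule ccontr)
      assume "{?g a<..<?g b} \<inter> S \<noteq> {}"
      then obtain s where s: "?g a < s" "s < ?g b" "s \<in> S" by auto
      have sI: "s \<in> {0..1}" using s g(1)[OF in1(1)] g(1)[OF in1(2)] by auto
      have "a < f s" "f s < b"
        using strict_mono_onD[OF D(3), of "?g a" s] strict_mono_onD[OF D(3), of s "?g b"] g in1 s sI
        by auto
      then show False using ab s sI by auto
    qed
    then obtain k c where kc: "\<forall>t\<in>{?g a..?g b}. f t = real n powi k * t + c"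
      using pl[of "?g a" "?g b"] lt g(1)[OF in1(1)] g(1)[OF in1(2)] by auto
    have "\<forall>t\<in>{a..b}. ?g t = real n powi (- k) * t + - (real n powi (-k)) * c"
    proof
      fix t assume t: "t \<in> {a..b}"
      have tI: "t \<in> {0..1}" using t ab by auto
      have "?g t \<in> {?g a..?g b}"
        using strict_mono_on_leD[OF mono, of a t] strict_mono_on_leD[OF mono, of t b] t tI in1 by auto
      then have "t = real n powi k * ?g t + c" using kc g(2)[OF tI] by metis
      moreover have "real n powi k \<noteq> 0" using n by (simp add: power_int_not_zero)
      ultimately show "?g t = real n powi (- k) * t + - (real n powi (-k)) * c"
        by (simp add: power_int_minus field_simps)
    qed
    then show "\<exists>(k::int) c. \<forall>t\<in>{a..b}. ?g t = real n powi k * t + c" by blast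
  qed
  have "?g 0 = 0" "?g 1 = 1" using gf(1)[of 0] gf(1)[of 1] D(5,6) by auto
  then show ?thesis using mono cont npl by (intro thompson_carrierI) auto
qed

lemma thompson_carrier_compose:
  assumes f: "f \<in> thompson_carrier n" and g: "g \<in> thompson_carrier n" and n: "n > 0"
  shows "compose {0..1} f g \<in> thompson_carrier n"
proof -
  note F = thompson_carrierD[OF f] and G = thompson_carrierD[OF g]
  let ?h = "compose {0..1} f g" and ?g' = "restrict (inv_into {0..1} g) {0..1}"
  have gI: "g x \<in> {0..1}" if "x \<in> {0..1}" for x using that G(2) by (auto simp: bij_betw_def)
  obtain S where S: "finite S" "S \<subseteq> nadic n"
    and plf: "\<And>a b. \<lbrakk>0 \<le> a; a < b; b \<le> 1; {a<..<b} \<inter> S = {}\<rbrakk> \<Longrightarrow>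
        (\<exists>(k::int) c. \<forall>t\<in>{a..b}. f t = real n powi k * t + c)"
    using nadic_plE[OF F(7)] by metis
  obtain T where T: "finite T" "T \<subseteq> nadic n"
    and plg: "\<And>a b. \<lbrakk>0 \<le> a; a < b; b \<le> 1; {a<..<b} \<inter> T = {}\<rbrakk> \<Longrightarrow>
        (\<exists>(k::int) c. \<forall>t\<in>{a..b}. g t = real n powi k * t + c)"
    using nadic_plE[OF G(7)] by metis
  have g': "?g' y \<in> {0..1}" "g (?g' y) = y" if "y \<in> {0..1}" for y
    using that bij_betw_apply[OF bij_betw_inv_into[OF G(2)] that] bij_betw_inv_into_right[OF G(2) that]
    by auto
  have npl: "nadic_pl n ?h" unfolding nadic_pl_def
  proof (intro exI[of _ "T \<union> ?g' ` (S \<inter> {0..1})"] conjI allI impI)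
    show "finite (T \<union> ?g' ` (S \<inter> {0..1}))" using S T by auto
    show "T \<union> ?g' ` (S \<inter> {0..1}) \<subseteq> nadic n"
      using S T thompson_carrier_nadic[OF thompson_carrier_inv[OF g n] n] by auto
    fix a b :: real
    assume ab: "0 \<le> a \<and> a < b \<and> b \<le> 1 \<and> {a<..<b} \<inter> (T \<union> ?g' ` (S \<inter> {0..1})) = {}"
    then have in1: "a \<in> {0..1}" "b \<in> {0..1}" by auto
    obtain k c where kc: "\<forall>t\<in>{a..b}. g t = real n powi k * t + c" using plg[of a b] ab by auto
    have lt: "g a < g b" using strict_mono_onD[OF G(3)] ab in1 by auto
    have "{g a<..<g b} \<inter> S = {}"
    proof (rule ccontr)
      assume "{g a<..<g b} \<inter> S \<noteq> {}"
      then obtain s where s: "g a < s" "s < g b" "s \<in> S" by auto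
      have sI: "s \<in> {0..1}" using s gI[OF in1(1)] gI[OF in1(2)] by auto
      have "a < ?g' s"
        using strict_mono_on_leD[OF G(3), of "?g' s" a] g'[OF sI] in1 s by force
      moreover have "?g' s < b"
        using strict_mono_on_leD[OF G(3), of b "?g' s"] g'[OF sI] in1 s by force
      ultimately show False using ab s sI by auto
    qed
    then obtain l d where ld: "\<forall>t\<in>{g a..g b}. f t = real n powi l * t + d"
      using plf[of "g a" "g b"] lt gI[OF in1(1)] gI[OF in1(2)] by auto
    have "\<forall>t\<in>{a..b}. ?h t = real n powi (l + k) * t + (real n powi l * c + d)"
    proof
      fix t assume t: "t \<in> {a..b}"
      then have tI: "t \<in> {0..1}" using ab by auto
      have "g t \<in> {g a..g b}"
        using strict_mono_on_leD[OF G(3), of a t] strict_mono_on_leD[OF G(3), of t b] t tI in1 by auto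
      then have "f (g t) = real n powi l * (real n powi k * t + c) + d" using ld kc t by metis
      then show "?h t = real n powi (l + k) * t + (real n powi l * c + d)"
        using tI n by (simp add: compose_def power_int_add algebra_simps)
    qed
    then show "\<exists>(k::int) c. \<forall>t\<in>{a..b}. ?h t = real n powi k * t + c" by blast
  qed
  show ?thesis
  proof (rule thompson_carrierI)
    show "strict_mono_on {0..1} ?h"
      using strict_mono_onD[OF F(3)] strict_mono_onD[OF G(3)] gI
      by (intro strict_mono_onI) (simp add: compose_def)
    have "continuous_on {0..1} (\<lambda>x. f (g x))"
      using continuous_on_compose2[OF F(4) G(4)] gI by blast
    then show "continuous_on {0..1} ?h" by (rule continuous_on_eq) (auto simp: compose_def)
  qed (use F G npl in \<open>auto simp: compose_def\<close>)
qed

lemma thompson_carrier_id: "(\<lambda>x\<in>{0..1}. x) \<in> thompson_carrier n"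
proof (rule thompson_carrierI)
  show "nadic_pl n (\<lambda>x\<in>{0..1}. x)" unfolding nadic_pl_def
    by (rule exI[of _ "{}"]) (auto intro!: exI[of _ 0])
  show "continuous_on {0..1} (\<lambda>x\<in>{0..1}. x::real)"
    by (rule continuous_on_eq[OF continuous_on_id]) auto
qed (auto intro: strict_mono_onI)

lemma BijGroup_inv:
  assumes "f \<in> Bij S"
  shows "inv\<^bsub>BijGroup S\<^esub> f = restrict (inv_into S f) S"
  using group.inv_equality[OF group_BijGroup, of S "restrict (inv_into S f) S" f]
    restrict_inv_into_Bij[OF assms] assms
  by (simp add: BijGroup_def Bij_compose_restrict_eq)

lemma subgroup_thompson_carrier:
  assumes "n > 0"
  shows "subgroup (thompson_carrier n) (BijGroup {0..1})"
proof (rule group.subgroupI[OF group_BijGroup])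
  show "thompson_carrier n \<subseteq> carrier (BijGroup {0..1})"
    using thompson_carrierD(8) by (auto simp: BijGroup_def)
  show "thompson_carrier n \<noteq> {}" using thompson_carrier_id by blast
  show "inv\<^bsub>BijGroup {0..1}\<^esub> a \<in> thompson_carrier n" if "a \<in> thompson_carrier n" for a
    using thompson_carrier_inv[OF that assms] BijGroup_inv[OF thompson_carrierD(8)[OF that]] by simp
  show "a \<otimes>\<^bsub>BijGroup {0..1}\<^esub> b \<in> thompson_carrier n"
    if "a \<in> thompson_carrier n" "b \<in> thompson_carrier n" for a b
    using thompson_carrier_compose[OF that assms] thompson_carrierD(8) that by (simp add: BijGroup_def)
qed

theorem group_thompson_F: "n > 0 \<Longrightarrow> group (thompson_F n)"
  unfolding thompson_F_def
  using subgroup.subgroup_is_group[OF subgroup_thompson_carrier group_BijGroup] by blast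


lemma thompson_carrier_grid:
  assumes n: "n > 0" and ext: "f \<in> extensional {0..1}" and f01: "f 0 = 0" "f 1 = 1"
    and d0: "d 0 = 0" and dN: "d N = 1"
    and inc: "\<And>j. j < N \<Longrightarrow> d j < d (Suc j)"
    and nad: "\<And>j. j \<le> N \<Longrightarrow> d j \<in> nadic n"
    and aff: "\<And>j. j < N \<Longrightarrow> \<exists>(k::int) c. \<forall>t\<in>{d j..d (Suc j)}. f t = real n powi k * t + c"
  shows "f \<in> thompson_carrier n"
proof -
  have piece: "continuous_on {d j..d (Suc j)} f" "strict_mono_on {d j..d (Suc j)} f" if j: "j < N" for j
  proof -
    obtain k c where kc: "\<forall>t\<in>{d j..d (Suc j)}. f t = real n powi k * t + c" using aff[OF j] by blast
    have "continuous_on {d j..d (Suc j)} (\<lambda>t. real n powi k * t + c)" by (intro continuous_intros)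
    then show "continuous_on {d j..d (Suc j)} f" by (rule continuous_on_eq) (use kc in auto)
    show "strict_mono_on {d j..d (Suc j)} f"
      using kc n by (auto intro!: strict_mono_onI mult_strict_left_mono zero_less_power_int)
  qed
  have ge0: "d 0 \<le> d m" if "m \<le> N" for m
    using that
  proof (induction m)
    case (Suc m)
    then show ?case using inc[of m] by force
  qed simp
  have "continuous_on {d 0..d m} f \<and> strict_mono_on {d 0..d m} f" if "m \<le> N" for m
    using that
  proof (induction m)
    case 0
    then show ?case by (auto intro: strict_mono_onI)
  next
    case (Suc m)
    have le: "d 0 \<le> d m" "d m < d (Suc m)" using ge0[of m] inc[of m] Suc.prems by auto
    have un: "{d 0..d (Suc m)} = {d 0..d m} \<union> {d m..d (Suc m)}" using le by auto
    have IH: "continuous_on {d 0..d m} f" "strict_mono_on {d 0..d m} f" using Suc by auto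
    have P: "continuous_on {d m..d (Suc m)} f" "strict_mono_on {d m..d (Suc m)} f"
      using piece[of m] Suc.prems by auto
    have "continuous_on {d 0..d (Suc m)} f"
      unfolding un by (intro continuous_on_closed_Un IH P closed_atLeastAtMost)
    moreover have "strict_mono_on {d 0..d (Suc m)} f"
    proof (rule strict_mono_onI)
      fix r s assume rs: "r \<in> {d 0..d (Suc m)}" "s \<in> {d 0..d (Suc m)}" "r < s"
      consider "s \<le> d m" | "d m \<le> r" | "r < d m" "d m < s" by linarith
      then show "f r < f s"
      proof cases
        case 1 then show ?thesis using strict_mono_onD[OF IH(2), of r s] rs by auto
      next
        case 2 then show ?thesis using strict_mono_onD[OF P(2), of r s] rs by auto
      next
        case 3 then show ?thesis
          using strict_mono_onD[OF IH(2), of r "d m"] strict_mono_onD[OF P(2), of "d m" s] rs le by auto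
      qed
    qed
    ultimately show ?case ..
  qed
  from this[of N] have cont: "continuous_on {0..1} f" and mono: "strict_mono_on {0..1} f"
    using d0 dN by auto
  have "nadic_pl n f" unfolding nadic_pl_def
  proof (intro exI[of _ "d ` {..N}"] conjI allI impI)
    show "d ` {..N} \<subseteq> nadic n" using nad by auto
    fix a b :: real assume ab: "0 \<le> a \<and> a < b \<and> b \<le> 1 \<and> {a<..<b} \<inter> d ` {..N} = {}"
    define j where "j = Max {j. j \<le> N \<and> d j \<le> a}"
    have fin: "finite {j. j \<le> N \<and> d j \<le> a}" by (rule finite_subset[of _ "{..N}"]) auto
    have "0 \<in> {j. j \<le> N \<and> d j \<le> a}" using d0 ab by auto
    then have "j \<in> {j. j \<le> N \<and> d j \<le> a}" unfolding j_def using fin by (intro Max_in) auto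
    then have j: "j \<le> N" "d j \<le> a" by auto
    have "j \<noteq> N" using j dN ab by auto
    then have jN: "j < N" using j by auto
    have "\<not> d (Suc j) \<le> a"
    proof
      assume "d (Suc j) \<le> a"
      then have "Suc j \<le> j" unfolding j_def using fin jN by (intro Max_ge) (auto simp: j_def)
      then show False by simp
    qed
    moreover have "d (Suc j) \<notin> {a<..<b}" using ab jN by (auto simp: disjoint_iff)
    ultimately have "b \<le> d (Suc j)" by auto
    moreover obtain k c where "\<forall>t\<in>{d j..d (Suc j)}. f t = real n powi k * t + c" using aff[OF jN] by blast
    ultimately show "\<exists>(k::int) c. \<forall>t\<in>{a..b}. f t = real n powi k * t + c" using j by auto
  qed auto
  then show ?thesis using thompson_carrierI ext mono cont f01 by blast
qed

lemma subdiv_diff: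
  assumes "m \<le> p"
  shows "subdiv p m (Suc j) - subdiv p m j =
    (if j < m \<or> j > m + p then 1 / real (p + 1) else 1 / real (p + 1) ^ 2)"
proof -
  consider "j < m" | "m \<le> j" "j < m + p + 1" | "j = m + p + 1" | "j > m + p + 1" by linarith
  then show ?thesis
  proof cases
    case 1 then show ?thesis by (simp add: subdiv_def diff_divide_distrib[symmetric])
  next
    case 2 then show ?thesis
      by (auto simp: subdiv_def of_nat_diff diff_divide_distrib[symmetric])
  next
    case 3
    have *: "real (p + 1) / real (p + 1) ^ 2 = 1 / real (p + 1)"
      by (simp add: power2_eq_square)
    have "subdiv p m j = real m / real (p + 1) + real (p + 1) / real (p + 1) ^ 2"
      using 3 by (simp add: subdiv_def)
    moreover have "subdiv p m (Suc j) = real (m + 2) / real (p + 1)"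
      using 3 by (simp add: subdiv_def)
    ultimately show ?thesis unfolding * using 3
      by (simp add: add_divide_distrib[symmetric] diff_divide_distrib[symmetric])
  next
    case 4 then show ?thesis
      by (auto simp: subdiv_def of_nat_diff diff_divide_distrib[symmetric])
  qed
qed

lemma subdiv_less: "m \<le> p \<Longrightarrow> subdiv p m j < subdiv p m (Suc j)"
proof -
  assume "m \<le> p"
  then have "subdiv p m (Suc j) - subdiv p m j > 0" by (simp only: subdiv_diff) auto
  then show ?thesis by simp
qed

lemma subdiv_strict_mono: "m \<le> p \<Longrightarrow> strict_mono (subdiv p m)"
  by (simp add: strict_mono_Suc_iff subdiv_less)

lemma subdiv_0: "subdiv p m 0 = 0"
  by (simp add: subdiv_def)

lemma subdiv_1: "m \<le> p \<Longrightarrow> subdiv p m (2 * p + 1) = 1"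
proof (cases "m = p")
  case True
  have *: "real (p + 1) / real (p + 1) ^ 2 = 1 / real (p + 1)"
    by (simp add: power2_eq_square)
  have "subdiv p m (2 * p + 1) = real p / real (p + 1) + real (p + 1) / real (p + 1) ^ 2"
    using True by (simp add: subdiv_def)
  then show ?thesis unfolding * by (simp add: add_divide_distrib[symmetric])
next
  case False
  assume "m \<le> p"
  with False show ?thesis by (simp add: subdiv_def)
qed

lemma subdiv_nadic: "subdiv p m j \<in> nadic (p + 1)"
proof -
  have "real a / real (p + 1) ^ k \<in> nadic (p + 1)" for a k
    unfolding nadic_def by (rule CollectI, rule exI[of _ "int a"], rule exI[of _ k]) simp
  from this[of _ 1] this
  have "real a / real (p + 1) \<in> nadic (p + 1)" "real a / real (p + 1) ^ 2 \<in> nadic (p + 1)" for a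
    by simp_all
  then show ?thesis unfolding subdiv_def by (auto intro!: nadic_add simp del: of_nat_add of_nat_Suc of_nat_diff)
qed

lemma subdiv_map_eq:
  assumes i: "i \<le> p" and j: "j < 2 * p + 1" and t: "t \<in> {subdiv p p j..subdiv p p (Suc j)}"
  shows "subdiv_map p i t =
    subdiv p i j + (t - subdiv p p j) / (subdiv p p (Suc j) - subdiv p p j)
                        * (subdiv p i (Suc j) - subdiv p i j)"
proof -
  note m = subdiv_strict_mono[OF order_refl, of p]
  have "subdiv p p 0 \<le> subdiv p p j" "subdiv p p (Suc j) \<le> subdiv p p (2 * p + 1)"
    using j by (auto simp: strict_mono_less_eq[OF m])
  then have tI: "t \<in> {0..1}" using t subdiv_0[of p p] subdiv_1[of p p] by auto
  define q where "q = (LEAST j. t \<le> subdiv p p (Suc j))"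
  have q1: "t \<le> subdiv p p (Suc q)" unfolding q_def by (rule LeastI[of _ j]) (use t in auto)
  have qj: "q \<le> j" unfolding q_def by (rule Least_le) (use t in auto)
  have val: "subdiv_map p i t = subdiv p i q + (t - subdiv p p q) / (subdiv p p (Suc q) - subdiv p p q)
                        * (subdiv p i (Suc q) - subdiv p i q)"
    using tI unfolding subdiv_map_def Let_def q_def by simp
  show ?thesis
  proof (cases "q = j")
    case False
    then have "Suc q \<le> j" using qj by auto
    then have "subdiv p p (Suc q) \<le> subdiv p p j" by (simp add: strict_mono_less_eq[OF m])
    then have eq: "t = subdiv p p j" "subdiv p p (Suc q) = subdiv p p j" using t q1 by auto
    then have "Suc q = j" using strict_mono_eq[OF m] by simp
    then show ?thesis using val eq subdiv_less[of p p q] by auto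
  qed (use val in simp)
qed

lemma subdiv_map_affine:
  assumes i: "i \<le> p" and j: "j < 2 * p + 1"
  shows "\<exists>(k::int) c. \<forall>t\<in>{subdiv p p j..subdiv p p (Suc j)}. subdiv_map p i t = real (p + 1) powi k * t + c"
proof -
  have "\<exists>k::int. (subdiv p i (Suc j) - subdiv p i j) / (subdiv p p (Suc j) - subdiv p p j) = real (p + 1) powi k"
  proof -
    have "\<exists>k::int. (if P then 1 / real (p + 1) else 1 / real (p + 1) ^ 2) /
       (if Q then 1 / real (p + 1) else 1 / real (p + 1) ^ 2) = real (p + 1) powi k" for P Q
    proof -
      let ?n = "real (p + 1)"
      have n0: "?n \<noteq> 0" by simp
      have "(1 / ?n ^ 2) / (1 / ?n) = ?n powi (-1)" "(1 / ?n) / (1 / ?n ^ 2) = ?n powi 1"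
        "x / x = ?n powi 0" if "x \<noteq> 0" for x
        using n0 that by (simp_all add: power2_eq_square power_int_minus divide_simps del: of_nat_add)
      from this[of 1] this(3)[of "1 / ?n"] this(3)[of "1 / ?n ^ 2"] show ?thesis
        using n0 by (cases P; cases Q) (simp only: if_True if_False; (blast | (rule exI[of _ 0], simp)))+
    qed
    then show ?thesis using i by (simp add: subdiv_diff)
  qed
  then obtain k :: int where
    k: "(subdiv p i (Suc j) - subdiv p i j) / (subdiv p p (Suc j) - subdiv p p j) = real (p + 1) powi k" ..
  have "subdiv_map p i t = real (p + 1) powi k * t + (subdiv p i j - real (p + 1) powi k * subdiv p p j)"
    if "t \<in> {subdiv p p j..subdiv p p (Suc j)}" for t
    using subdiv_map_eq[OF i j that] unfolding k[symmetric]
    by (simp add: diff_divide_distrib algebra_simps)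
  then show ?thesis
    by blast
qed

lemma subdiv_map_in_carrier:
  assumes i: "i \<le> p"
  shows "subdiv_map p i \<in> thompson_carrier (p + 1)"
proof (rule thompson_carrier_grid[where d = "subdiv p p" and N = "2 * p + 1"])
  show "subdiv_map p i \<in> extensional {0..1}" by (simp add: subdiv_map_def)
  show "subdiv_map p i 0 = 0"
    using subdiv_map_eq[OF i, of 0 0] subdiv_less[of p p 0] by (simp add: subdiv_0)
  show "subdiv_map p i 1 = 1"
    using subdiv_map_eq[OF i, of "2 * p" 1] subdiv_less[of p p "2 * p"] subdiv_1[of p p] subdiv_1[OF i]
    by simp
qed (use subdiv_0 subdiv_1[of p p] subdiv_less[of p p] subdiv_nadic[of p p] subdiv_map_affine[OF i] in auto)

lemma thompson_gen_in_carrier: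
  assumes p: "p \<ge> 1"
  shows "thompson_gen p i \<in> thompson_carrier (p + 1)"
proof (cases "i < p")
  case True
  then show ?thesis using subdiv_map_in_carrier[of i p] by (simp add: thompson_gen_def)
next
  case False
  define f where "f = thompson_gen p i"
  define d where "d j = (case j of 0 \<Rightarrow> 0 | Suc l \<Rightarrow> (real p + subdiv p p l) / real (p + 1))" for j
  have f: "f t = (if t \<le> real p / real (p + 1) then t
       else (real p + subdiv_map p 0 (real (p + 1) * t - real p)) / real (p + 1))" if "t \<in> {0..1}" for t
    using False that by (simp add: f_def thompson_gen_def)
  note c0 = thompson_carrierD[OF subdiv_map_in_carrier[of 0 p]]
  have ge: "subdiv p p l \<ge> 0" for l
    using strict_mono_less_eq[OF subdiv_strict_mono[of p p], of 0 l] subdiv_0[of p p] by simp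
  have le: "subdiv p p l \<le> 1" if "l \<le> 2 * p + 1" for l
    using strict_mono_less_eq[OF subdiv_strict_mono[of p p], of l "2 * p + 1"] subdiv_1[of p p] that by simp
  have P: "real (p + 1) > 0" "real (p + 1) = real p + 1" by simp_all
  have f': "f t = (real p + subdiv_map p 0 (real (p + 1) * t - real p)) / real (p + 1)"
    if "t \<in> {0..1}" "real p / real (p + 1) \<le> t" for t
    using f[OF that(1)] that(2) c0(5) by (cases "t = real p / real (p + 1)") auto
  have "f \<in> thompson_carrier (p + 1)"
  proof (rule thompson_carrier_grid[where d = d and N = "2 * p + 2"])
    show "f \<in> extensional {0..1}" using False by (simp add: f_def thompson_gen_def)
    show "f 0 = 0" using f[of 0] by simp
    show "f 1 = 1" using f'[of 1] c0(6) by simp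
    show "d 0 = 0" by (simp add: d_def)
    show "d (2 * p + 2) = 1" using subdiv_1[of p p] by (simp add: d_def)
    show "d j < d (Suc j)" if "j < 2 * p + 2" for j
      using p subdiv_0[of p p] subdiv_less[of p p "j - 1"]
      by (cases j) (auto simp: d_def intro!: divide_strict_right_mono)
    show "d j \<in> nadic (p + 1)" if "j \<le> 2 * p + 2" for j
    proof (cases j)
      case 0
      then show ?thesis using nadic_of_int[of 0 "p + 1"] by (simp add: d_def)
    next
      case (Suc l)
      have "1 / real (p + 1) = real (p + 1) powi (-1)" by (simp add: power_int_minus divide_simps)
      then have "1 / real (p + 1) \<in> nadic (p + 1)" using nadic_powi[of "p + 1" "-1"] by (simp only:)
      moreover have "real p \<in> nadic (p + 1)" using nadic_of_int[of "int p" "p + 1"] by simp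
      ultimately have "(real p + subdiv p p l) * (1 / real (p + 1)) \<in> nadic (p + 1)"
        using subdiv_nadic[of p p l] by (intro nadic_mult nadic_add) auto
      then show ?thesis using Suc by (simp add: d_def)
    qed
    fix j assume j: "j < 2 * p + 2"
    show "\<exists>(k::int) c. \<forall>t\<in>{d j..d (Suc j)}. f t = real (p + 1) powi k * t + c"
    proof (cases j)
      case 0
      have "real p / real (p + 1) \<le> 1" by simp
      then have "f t = real (p + 1) powi 0 * t + 0" if "t \<in> {d j..d (Suc j)}" for t
      proof -
        have t: "0 \<le> t" "t \<le> real p / real (p + 1)" using that 0 subdiv_0[of p p] by (auto simp: d_def)
        then have "t \<le> 1" using \<open>real p / real (p + 1) \<le> 1\<close> by linarith
        then show ?thesis using f[of t] t by simp
      qed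
      then show ?thesis by blast
    next
      case (Suc l)
      then have l: "l < 2 * p + 1" using j by simp
      obtain k c where kc: "\<forall>t\<in>{subdiv p p l..subdiv p p (Suc l)}. subdiv_map p 0 t = real (p + 1) powi k * t + c"
        using subdiv_map_affine[of 0 p l] l by auto
      have "f t = real (p + 1) powi k * t + (real p + c - real (p + 1) powi k * real p) / real (p + 1)"
        if t: "t \<in> {d j..d (Suc j)}" for t
      proof -
        let ?s = "real (p + 1) * t - real p"
        have s: "?s \<in> {subdiv p p l..subdiv p p (Suc l)}"
          using t P(1) by (simp add: d_def Suc field_simps)
        have "?s \<ge> 0" "?s \<le> 1" using s ge[of l] le[of "Suc l"] l by auto
        then have "real p \<le> t * real (p + 1)" "t * real (p + 1) \<le> 1 * real (p + 1)"
          by (auto simp: algebra_simps)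
        then have "real p / real (p + 1) \<le> t" "t \<le> 1"
          using P(1) by (simp_all only: pos_divide_le_eq mult_le_cancel_right_pos)
        moreover then have "0 \<le> t" using P(1) by (meson divide_nonneg_pos of_nat_0_le_iff order_trans)
        ultimately have "f t = (real p + subdiv_map p 0 ?s) / real (p + 1)" using f' by auto
        also have "\<dots> = (real p + (real (p + 1) powi k * ?s + c)) / real (p + 1)" using kc s by auto
        also have "\<dots> = real (p + 1) powi k * t + (real p + c - real (p + 1) powi k * real p) / real (p + 1)"
        proof -
          have "(q + (K * (N * t - q) + c)) / N = K * t + (q + c - K * q) / N" if "N > 0" for q K N :: real
            using that by (simp add: field_simps)
          then show ?thesis using P(1) by blast
        qed
        finally show ?thesis .
      qed
      then show ?thesis by blast
    qed
  qed auto
  then show ?thesis by (simp add: f_def)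
qed

lemma thompson_gens_subset: "p \<ge> 1 \<Longrightarrow> thompson_gens p \<subseteq> carrier (thompson_F (p + 1))"
  using thompson_gen_in_carrier by (auto simp: thompson_gens_def thompson_F_def)

end

theory Submission
  imports Defs
begin

text \<open>
  Cut \<open>(0,1)\<close> into the cells obtained by subdividing the first and the last interval over and over
  again, and let \<open>chart p\<close> map the real line onto \<open>(0,1)\<close> so that each unit interval between
  integers is mapped affinely onto one cell.  In this coordinate \<open>x\<^sub>0\<close> is the translation by
  \<open>-p\<close>, and for \<open>1 \<le> i \<le> p\<close> the generator \<open>x\<^sub>i\<close> fixes \<open>(-\<infinity>, i-1]\<close>, contracts the \<open>p + 1\<close>
  cells in \<open>[i-1, i+p]\<close> to the single cell \<open>[i-1, i]\<close>, and translates \<open>[i+p, \<infinity>)\<close> by \<open>-p\<close>.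

  A word is read from left to right, and each letter moves the points of the line by its inverse.
  So \<open>x\<^sub>0\<close> and its inverse only transport the line to the right and to the left, while
  \<open>x\<^sub>i\<close> splits the cell \<open>[i-1, i]\<close> into \<open>p + 1\<close> cells and its inverse joins such cells.  Splits and
  joins happen next to the origin, so a place that has to be changed must first be brought there.

  Consider two jobs.  The first is to split a cell that lies \<open>m\<close> blocks (of \<open>p\<close> cells) to the left
  of the origin and to return.  The second is to split the cell at the origin, then the last of its
  parts, and so on, \<open>m + 1\<close> times in all; the last of these splits takes place \<open>m\<close> blocks to the
  right.  The two jobs have disjoint supports and commute (\<open>words_commute\<close>).  Let \<open>w\<close>
  perform both.  If the right job is done last, its word ends in \<open>x\<^sub>0\<^sup>m\<close>; if the left job is done
  last, its word ends in \<open>x\<^sub>0\<close> to the power \<open>-(m + 1)\<close>.  Both words have length \<open>5 m + 3\<close>, and cancelling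
  at their ends gives words of length \<open>5 m + 3 - |l|\<close> for \<open>w x\<^sub>0\<^sup>l\<close> if \<open>|l| \<le> m\<close> (\<open>short_word\<close>).

  These words are shortest (\<open>seesaw_lower_bound\<close>).  Any word for \<open>w x\<^sub>0\<^sup>l\<close> has \<open>m + 2\<close> more splits than
  joins, because this difference is seen from the translations near \<open>-\<infinity>\<close> and \<open>\<infinity>\<close>
  (\<open>exponent_unique\<close>).  It must perform both jobs in some order, and without joins the travel alone
  costs \<open>4 m + 1 - |l|\<close> letters \<open>x\<^sub>0\<close> or \<open>x\<^sub>0\<close> inverse.  A join pulls the two places together by at most one block
  (\<open>potential_run\<close>) and hence saves at most two steps of travel, but it costs two letters: itself
  and one more split.

  For the second seesaw condition, let a letter other than \<open>x\<^sub>0\<close> and its inverse follow \<open>w x\<^sub>0\<^sup>l\<close>.  A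
  split raises the required number of splits and leaves the bound on the travel intact.  A join
  lowers the required number of splits by one, so one has to show that it does not also shorten the travel:
  in \<open>travel_bound\<close> a route that meets the bound with equality moves monotonically and
  makes no join after the far right end has been reached.  On such a route the point that is at
  \<open>p\<close> when \<open>w x\<^sub>0\<^sup>l\<close> has been read would end at an integer, whereas the join moves \<open>p\<close> into the interior
  of a cell.
\<close>

section \<open>Splitting and joining cells of the line\<close>

definition split_at :: "nat \<Rightarrow> nat \<Rightarrow> real \<Rightarrow> real" where
  "split_at p i y =
    (if y \<le> real i - 1 then y
     else if y \<le> real i then real i - 1 + (real p + 1) * (y - (real i - 1))
     else y + real p)"

definition join_at :: "nat \<Rightarrow> nat \<Rightarrow> real \<Rightarrow> real" where
  "join_at p i y =
    (if y \<le> real i - 1 then y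
     else if y \<le> real i + real p then real i - 1 + (y - (real i - 1)) / (real p + 1)
     else y - real p)"

lemma split_at_cases:
  "y \<le> real i - 1 \<Longrightarrow> split_at p i y = y"
  "real i - 1 \<le> y \<Longrightarrow> y \<le> real i \<Longrightarrow> split_at p i y = real i - 1 + (real p + 1) * (y - (real i - 1))"
  "real i \<le> y \<Longrightarrow> split_at p i y = y + real p"
  by (cases "y = real i - 1"; cases "y = real i"; auto simp: split_at_def algebra_simps)+

lemma join_at_cases:
  "y \<le> real i - 1 \<Longrightarrow> join_at p i y = y"
  "real i - 1 \<le> y \<Longrightarrow> y \<le> real i + real p \<Longrightarrow> join_at p i y = real i - 1 + (y - (real i - 1)) / (real p + 1)"
  "real i + real p \<le> y \<Longrightarrow> join_at p i y = y - real p"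
  by (cases "y = real i - 1"; cases "y = real i + real p"; auto simp: join_at_def algebra_simps add_nonneg_eq_0_iff)+

text \<open>The letter \<open>(i, up)\<close> stands for the generator \<open>x\<^sub>i\<close> if \<open>up\<close> holds, and for its inverse otherwise.
  The function \<open>move\<close> is the action of the inverse of the letter, so that \<open>run p hs\<close>, which applies
  the letters from left to right, is the inverse of the group element spelled by \<open>hs\<close>.\<close>

type_synonym letter = "nat \<times> bool"

fun move :: "nat \<Rightarrow> letter \<Rightarrow> real \<Rightarrow> real" where
  "move p (i, up) y =
    (if i = 0 then (if up then y + real p else y - real p)
     else (if up then split_at p i y else join_at p i y))"

fun run :: "nat \<Rightarrow> letter list \<Rightarrow> real \<Rightarrow> real" where
  "run p [] y = y"
| "run p (a # hs) y = run p hs (move p a y)"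

lemma run_append: "run p (hs @ hs') y = run p hs' (run p hs y)"
  by (induction hs arbitrary: y) auto

fun inv_letter :: "letter \<Rightarrow> letter" where
  "inv_letter (i, up) = (i, \<not> up)"

lemma join_split_at: "p \<ge> 1 \<Longrightarrow> join_at p i (split_at p i y) = y"
  and split_join_at: "p \<ge> 1 \<Longrightarrow> split_at p i (join_at p i y) = y"
proof -
  assume p: "p \<ge> 1"
  define t where "t = y - (real i - 1)"
  have y: "y = real i - 1 + t" by (simp add: t_def)
  define Z D where "Z = (real p + 1) * t" and "D = t / (real p + 1)"
  have 1: "Z > 0" "D > 0" if "t > 0" using that by (simp_all add: Z_def D_def)
  have 2: "Z \<le> real p + 1" if "t \<le> 1" using mult_left_mono[OF that, of "real p + 1"] by (simp add: Z_def)
  have 3: "D \<le> 1" if "t \<le> real p + 1" using that by (simp add: D_def)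
  have 4: "Z / (real p + 1) = t" "(real p + 1) * D = t"
    by (simp_all add: Z_def D_def add_nonneg_eq_0_iff)
  have "split_at p i y = (if t \<le> 0 then real i - 1 + t else if t \<le> 1 then real i - 1 + Z else real i - 1 + t + real p)"
    unfolding y split_at_def Z_def by auto
  then show "join_at p i (split_at p i y) = y"
    using 1 2 4 p unfolding y by (auto simp: join_at_def)
  have "join_at p i y = (if t \<le> 0 then real i - 1 + t else if t \<le> real p + 1 then real i - 1 + D else real i - 1 + t - real p)"
    unfolding y join_at_def D_def by auto
  then show "split_at p i (join_at p i y) = y"
    using 1(2) 3 4(2) p unfolding y by (auto simp: split_at_def)
qed

lemma move_inv:
  assumes "p \<ge> 1"
  shows "move p (inv_letter a) (move p a y) = y"
  using assms by (cases a) (auto simp: join_split_at split_join_at)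

lemma move_strict_mono: "strict_mono (move p a)"
proof (cases a)
  case (Pair i up)
  have pos: "real p + 1 > 0" by simp
  have s: "split_at p i x < split_at p i y" if xy: "x < y" for x y
  proof -
    define X Y where "X = (real p + 1) * (x - (real i - 1))" and "Y = (real p + 1) * (y - (real i - 1))"
    have "X < Y"
      unfolding X_def Y_def using xy by (intro mult_strict_left_mono) auto
    moreover have "Y > 0" if "y > real i - 1"
      unfolding Y_def using that by simp
    moreover have "X \<le> (real p + 1) * 1" if "x \<le> real i"
      unfolding X_def using that by (intro mult_left_mono) auto
    ultimately show ?thesis using xy unfolding split_at_def X_def[symmetric] Y_def[symmetric] by auto
  qed
  have j: "join_at p i x < join_at p i y" if xy: "x < y" for x y
  proof -
    define X Y where "X = (x - (real i - 1)) / (real p + 1)" and "Y = (y - (real i - 1)) / (real p + 1)"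
    have "X < Y"
      unfolding X_def Y_def using xy by (intro divide_strict_right_mono) auto
    moreover have "Y > 0" if "y > real i - 1"
      unfolding Y_def using that by simp
    moreover have "X \<le> 1" if "x \<le> real i + real p"
      unfolding X_def using that by simp
    ultimately show ?thesis using xy unfolding join_at_def X_def[symmetric] Y_def[symmetric] by auto
  qed
  show ?thesis unfolding Pair using s j by (auto intro!: strict_monoI)
qed

lemma run_strict_mono: "strict_mono (run p hs)"
proof (induction hs)
  case (Cons a hs)
  then show ?case using move_strict_mono[of p a] by (auto simp: strict_mono_def)
qed (auto simp: strict_mono_def)

lemma run_less: "x < y \<Longrightarrow> run p hs x < run p hs y"
  using run_strict_mono by (auto simp: strict_mono_def)

section \<open>Blocks and travel\<close>

definition block :: "nat \<Rightarrow> real \<Rightarrow> int" where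
  "block p y = \<lfloor>y / real p\<rfloor>"

definition is_join :: "letter \<Rightarrow> bool" where
  "is_join a \<longleftrightarrow> fst a \<noteq> 0 \<and> \<not> snd a"

definition is_split :: "letter \<Rightarrow> bool" where
  "is_split a \<longleftrightarrow> fst a \<noteq> 0 \<and> snd a"

lemma is_split_iff: "is_split (i, up) \<longleftrightarrow> i \<noteq> 0 \<and> up"
  by (simp add: is_split_def)

lemma is_join_iff: "is_join (i, up) \<longleftrightarrow> i \<noteq> 0 \<and> \<not> up"
  by (simp add: is_join_def)

lemma block_mono: "x \<le> y \<Longrightarrow> block p x \<le> block p y"
  unfolding block_def by (intro floor_mono divide_right_mono) auto

lemma block_shift:
  assumes "p \<ge> 1"
  shows "block p (y + real p) = block p y + 1" "block p (y - real p) = block p y - 1"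
  using assms by (simp_all add: block_def add_divide_distrib diff_divide_distrib)

lemma block_eq_0: "0 \<le> y \<Longrightarrow> y < real p \<Longrightarrow> block p y = 0"
  unfolding block_def by (simp add: floor_eq_iff)

lemma split_at_bounds:
  assumes p: "p \<ge> 1" 
  shows "y \<le> split_at p i y" "split_at p i y \<le> y + real p"
proof -
  define t where "t = y - (real i - 1)"
  have "(real p + 1) * t = t + real p * t" by (simp add: algebra_simps)
  moreover have "real p * t \<ge> 0" if "t \<ge> 0" using that by simp
  moreover have "real p * t \<le> real p" if "t \<le> 1" using that by (simp add: mult_left_le)
  ultimately show "y \<le> split_at p i y" "split_at p i y \<le> y + real p"
    by (auto simp: split_at_def t_def)
qed

lemma join_at_bounds:
  assumes p: "p \<ge> 1" 
  shows "join_at p i y \<le> y" "y \<le> join_at p i y + real p"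
proof -
  have *: "split_at p i (join_at p i y) = y" if "i > 0"
    using move_inv[OF p, of "(i, False)" y] that by simp
  have **: "join_at p 0 y \<le> y \<and> y \<le> join_at p 0 y + real p"
  proof -
    define t where "t = y + 1"
    have "t / (real p + 1) \<le> t" if "t \<ge> 0" using that by (simp add: divide_le_eq algebra_simps)
    moreover have "t \<le> t / (real p + 1) + real p" if "t \<le> real p + 1"
      using that mult_left_mono[OF that, of "real p"] by (simp add: field_simps)
    ultimately show ?thesis unfolding join_at_def t_def by auto
  qed
  show "join_at p i y \<le> y" "y \<le> join_at p i y + real p"
    using * ** split_at_bounds[OF p, where y = "join_at p i y" and i = i] by (cases "i = 0"; force)+
qed

lemma move_nonpos:
  assumes "fst a \<noteq> 0" "y \<le> 0"
  shows "move p a y = y"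
  using assms by (cases a) (auto simp: split_at_def join_at_def)

lemma move_pos:
  assumes "fst a \<noteq> 0" "y > 0"
  shows "move p a y > 0"
  using assms strict_monoD[OF move_strict_mono, of 0 y p a] move_nonpos[OF assms(1), of 0 p] by simp

text \<open>If \<open>[i-1, i]\<close> is split, everything from the last of its \<open>p + 1\<close> parts onwards moves to the next block:
  the part itself moves from block 0 to block 1, and points beyond it move by \<open>p\<close>.\<close>

lemma split_at_block:
  assumes "p \<ge> 1" "y \<ge> real i - 1 + real p / (real p + 1)"
    "1 \<le> i" "i \<le> p"
  shows "block p (split_at p i y) \<ge> block p y + 1"
proof (cases "y < real i")
  case True
  have q: "real p / (real p + 1) > 0" using assms(1) by simp
  have "(real p + 1) * (y - (real i - 1)) \<ge> (real p + 1) * (real p / (real p + 1))"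
    using assms(2) by (intro mult_left_mono) auto
  moreover have "(real p + 1) * (real p / (real p + 1)) = real p" by (simp add: add_nonneg_eq_0_iff)
  moreover have "real i - 1 < y" using q assms(2) by linarith
  moreover then have "0 \<le> y" using assms(3) by simp
  ultimately have "split_at p i y \<ge> real i - 1 + real p" "0 \<le> y" using True by (auto simp: split_at_def)
  then have "block p (split_at p i y) \<ge> block p (0 + real p)"
    using assms by (intro block_mono) auto
  moreover have "block p y = 0" using True assms \<open>0 \<le> y\<close> by (intro block_eq_0) auto
  ultimately show ?thesis using block_shift[OF assms(1), of 0] by (simp add: block_def)
next
  case False
  then have "split_at p i y = y + real p" using assms
    by (simp add: split_at_cases)
  then show ?thesis using block_shift[OF assms(1)] by simp
qed

text \<open>The distance between two points, counted in blocks, decreases only at joins, and then by at most one.\<close>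

lemma gap_step:
  assumes p: "p \<ge> 1" and a: "fst a \<le> p" and xy: "x < y"
  shows "block p (move p a y) - block p (move p a x) \<ge> block p y - block p x - (if is_join a then 1 else 0)"
proof (cases a)
  case (Pair i up)
  consider "i = 0" | "i > 0" "up" | "i > 0" "\<not> up" by auto
  then show ?thesis
  proof cases
    case 1
    then show ?thesis using block_shift[OF p] by (simp add: Pair is_join_def)
  next
    case 3
    have "block p (join_at p i x) \<le> block p x"
      using join_at_bounds[OF p] by (intro block_mono)
    moreover have "block p (y - real p) \<le> block p (join_at p i y)"
      using join_at_bounds[OF p, where y = y and i = i] by (intro block_mono) auto
    ultimately show ?thesis using 3 block_shift[OF p, of y] by (simp add: Pair is_join_def)
  next
    case 2
    have "block p (split_at p i y) - block p (split_at p i x) \<ge> block p y - block p x"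
    proof (cases "x \<le> real i - 1")
      case True
      then have "split_at p i x = x" by (simp add: split_at_def)
      then show ?thesis using split_at_bounds(1)[OF p, where y = y and i = i] block_mono by simp
    next
      case False
      note x = this
      show ?thesis
      proof (cases "y < real i")
        case True
        then have "block p x = 0" "block p y = 0"
          using x xy 2 a by (auto intro!: block_eq_0 simp: Pair)
        moreover have "split_at p i x \<le> split_at p i y"
          using strict_monoD[OF move_strict_mono xy, of p a] 2 by (simp add: Pair)
        ultimately show ?thesis using block_mono by fastforce
      next
        case False
        then have "split_at p i y = y + real p"
          by (simp add: split_at_cases)
        moreover have "block p (split_at p i x) \<le> block p (x + real p)"
          using split_at_bounds[OF p] by (intro block_mono)
        ultimately show ?thesis using block_shift[OF p] by simp
      qed
    qed
    then show ?thesis using 2 by (simp add: Pair is_join_def)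
  qed
qed

abbreviation "rights hs \<equiv> count_list hs (0::nat, True)"
abbreviation "lefts hs \<equiv> count_list hs (0::nat, False)"
abbreviation "splits hs \<equiv> length (filter is_split hs)"
abbreviation "joins hs \<equiv> length (filter is_join hs)"

lemma length_letters: "length hs = rights hs + lefts hs + splits hs + joins hs"
proof (induction hs)
  case (Cons a hs)
  obtain i up where "a = (i, up)" by (cases a)
  with Cons show ?case by (auto simp: is_split_def is_join_def)
qed simp

text \<open>The truncation at 0 makes the depth invariant under splits and joins, which fix
  \<open>(-\<infinity>, 0]\<close>; so the variation of the depth is a lower bound for the number of translations.\<close>

definition depth :: "nat \<Rightarrow> real \<Rightarrow> int" where
  "depth p y = min (block p y) 0"

lemma depth_run:
  assumes p: "p \<ge> 1"
  shows "depth p (run p hs y) \<le> depth p y + int (rights hs) \<and>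
    depth p y - int (lefts hs) \<le> depth p (run p hs y)"
proof (induction hs arbitrary: y)
  case (Cons a hs)
  have *: "depth p (move p a y) = depth p y" if "fst a \<noteq> 0"
  proof (cases "y \<le> 0")
    case True then show ?thesis using move_nonpos[OF that] by simp
  next
    case False
    then have "block p y \<ge> 0" "block p (move p a y) \<ge> 0"
      using block_mono[of 0] move_pos[OF that, of y p] by (force simp: block_def)+
    then show ?thesis by (simp add: depth_def)
  qed
  obtain i up where a: "a = (i, up)" by (cases a)
  show ?case
    using Cons[of "move p a y"] * block_shift[OF p, of y]
    by (cases "i = 0"; cases up; force simp: a depth_def)+
qed auto

section \<open>Intact intervals\<close>

text \<open>The interval \<open>[a, b]\<close> is intact under \<open>u\<close> if \<open>u\<close> maps it affinely onto one of the intervals that arise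
  when a cell is subdivided into \<open>p + 1\<close> equal parts repeatedly.  A job that splits \<open>[a, b]\<close> is not done
  as long as the interval is intact.\<close>

definition intact :: "nat \<Rightarrow> (real \<Rightarrow> real) \<Rightarrow> real \<Rightarrow> real \<Rightarrow> bool" where
  "intact p u a b \<longleftrightarrow> (\<exists>(c::int) (k::nat). \<forall>t\<in>{a..b}. u t = (of_int c + (t - a) / (b - a)) / (real p + 1) ^ k)"

lemma intact_length:
  assumes "intact p u a b" "a < b"
  shows "u b - u a \<le> 1"
proof -
  obtain c k where ck: "\<forall>t\<in>{a..b}. u t = (of_int c + (t - a) / (b - a)) / (real p + 1) ^ k"
    using assms unfolding intact_def by blast
  have "u b - u a = 1 / (real p + 1) ^ k"
    using bspec[OF ck, of a] bspec[OF ck, of b] assms(2)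
    by (simp add: diff_divide_distrib[symmetric])
  moreover have "(real p + 1) ^ k \<ge> 1" by (intro one_le_power) simp
  ultimately show ?thesis by simp
qed

text \<open>A standard interval lies in one cell, on one side of each integer.  Every letter therefore maps it
  affinely onto a standard interval again, except for a split of the very cell that it fills.  The
  last conclusion locates the start of the last of the \<open>p + 1\<close> parts.\<close>

lemma intact_step:
  assumes p: "p \<ge> 1" and I: "intact p u a b" and ab: "a < b"
    and B: "\<not> intact p (\<lambda>t. move p l (u t)) a b"
  shows "is_split l" "u a = real (fst l) - 1" "u b = real (fst l)"
    "u (a + real p / (real p + 1) * (b - a)) = real (fst l) - 1 + real p / (real p + 1)"
proof -
  define n where "n = real p + 1"
  have n: "n > 1" "n \<noteq> 0" using p by (auto simp: n_def)
  obtain c k where ck: "\<forall>t\<in>{a..b}. u t = (of_int c + (t - a) / (b - a)) / n ^ k"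
    using I unfolding intact_def n_def by blast
  have nk: "n ^ k > 0" using n by simp
  have ua: "u a = of_int c / n ^ k" and ub: "u b = (of_int c + 1) / n ^ k"
    using ck ab by auto
  have range: "u a \<le> u t \<and> u t \<le> u b" if "t \<in> {a..b}" for t
  proof -
    have "0 \<le> (t - a) / (b - a)" "(t - a) / (b - a) \<le> 1" using that ab by auto
    then show ?thesis unfolding ua ub bspec[OF ck that] using nk
      by (intro conjI divide_right_mono) auto
  qed
  have isoI: "intact p (\<lambda>t. move p l (u t)) a b"
    if "\<And>t. t \<in> {a..b} \<Longrightarrow> move p l (u t) = (of_int c' + (t - a) / (b - a)) / n ^ k'" for c' k'
    unfolding intact_def n_def[symmetric] using that by blast
  obtain i up where l: "l = (i, up)" by (cases l)
  have shift: "intact p (\<lambda>t. move p l (u t)) a b"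
    if "\<And>t. t \<in> {a..b} \<Longrightarrow> move p l (u t) = u t + of_int z" for z :: int
  proof (rule isoI[where c' = "c + z * (int p + 1) ^ k" and k' = k])
    fix t assume t: "t \<in> {a..b}"
    have "of_int (c + z * (int p + 1) ^ k) = of_int c + of_int z * n ^ k" by (simp add: n_def)
    then have "(of_int (c + z * (int p + 1) ^ k) + (t - a) / (b - a)) / n ^ k = u t + of_int z"
      unfolding bspec[OF ck t] \<open>of_int _ = _ + _\<close> using nk n by (simp add: add_divide_distrib)
    then show "move p l (u t) = (of_int (c + z * (int p + 1) ^ k) + (t - a) / (b - a)) / n ^ k"
      using that[OF t] by simp
  qed
  have i0: "i \<noteq> 0"
  proof
    assume "i = 0"
    then show False using shift[of "if up then int p else - int p"] B by (auto simp: l)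
  qed
  \<comment> \<open>no integer is interior to the image of an intact interval\<close>
  have side: "u b \<le> of_int e \<or> of_int e \<le> u a" for e :: int
  proof -
    have "c + 1 \<le> e * (int p + 1) ^ k \<or> e * (int p + 1) ^ k \<le> c" by linarith
    then have "real_of_int (c + 1) \<le> of_int (e * (int p + 1) ^ k) \<or> real_of_int (e * (int p + 1) ^ k) \<le> of_int c"
      by (simp only: of_int_le_iff)
    then have "of_int c + 1 \<le> of_int e * n ^ k \<or> of_int e * n ^ k \<le> of_int c" by (simp add: n_def)
    then show ?thesis unfolding ua ub using nk by (simp add: field_simps)
  qed
  have left: False if "u b \<le> real i - 1"
    using shift[of 0] range that B i0 by (fastforce simp: l split_at_def join_at_def)
  then have la: "real i - 1 \<le> u a" using side[of "int i - 1"] by auto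
  show sp: "is_split l"
  proof (rule ccontr)
    assume "\<not> is_split l"
    then have up: "\<not> up" using i0 by (simp add: l is_split_def)
    consider "real i + real p \<le> u a" | "u b \<le> real i + real p" using side[of "int i + int p"] by auto
    then show False
    proof cases
      case 1
      have "move p l (u t) = u t + of_int (- int p)" if "t \<in> {a..b}" for t
        using range[OF that] 1 i0 up by (simp add: l join_at_cases)
      then show False using shift[of "- int p"] B by blast
    next
      case 2
      have "move p l (u t) = (of_int (c + int p * (int i - 1) * (int p + 1) ^ k) + (t - a) / (b - a)) / n ^ Suc k"
        if t: "t \<in> {a..b}" for t
      proof -
        have "move p l (u t) = real i - 1 + (u t - (real i - 1)) / n"
          using range[OF t] 2 la i0 up by (simp add: l join_at_cases(2) n_def)
        also have "\<dots> = (u t + real p * (real i - 1)) / n"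
          using n by (simp add: field_simps) (simp add: n_def algebra_simps)
        also have "u t + real p * (real i - 1) =
            (of_int (c + int p * (int i - 1) * (int p + 1) ^ k) + (t - a) / (b - a)) / n ^ k"
          using bspec[OF ck t] n by (simp add: n_def add_divide_distrib)
        finally show ?thesis by (simp add: mult.commute)
      qed
      then show False using isoI B by blast
    qed
  qed
  then have up: up by (simp add: l is_split_def)
  have ub_le: "u b \<le> real i"
  proof (rule ccontr)
    assume "\<not> u b \<le> real i"
    then have 1: "real i \<le> u a" using side[of "int i"] by auto
    have "move p l (u t) = u t + of_int (int p)" if "t \<in> {a..b}" for t
      using range[OF that] 1 i0 up by (simp add: l split_at_cases)
    then show False using shift[of "int p"] B by blast
  qed
  have k0: "k = 0"
  proof (rule ccontr)
    assume "k \<noteq> 0"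
    then obtain k' where k': "k = Suc k'" by (cases k) auto
    have "move p l (u t) = (of_int (c - int p * (int i - 1) * (int p + 1) ^ k') + (t - a) / (b - a)) / n ^ k'"
      if t: "t \<in> {a..b}" for t
    proof -
      have "move p l (u t) = real i - 1 + n * (u t - (real i - 1))"
        using range[OF t] ub_le la i0 up by (simp add: l split_at_cases(2) n_def)
      also have "\<dots> = n * u t - real p * (real i - 1)" by (simp add: n_def algebra_simps)
      also have "n * u t = (of_int c + (t - a) / (b - a)) / n ^ k'"
        using bspec[OF ck t] n by (simp add: k')
      also have "\<dots> - real p * (real i - 1) =
         (of_int (c - int p * (int i - 1) * (int p + 1) ^ k') + (t - a) / (b - a)) / n ^ k'"
        using n by (simp add: n_def add_divide_distrib diff_divide_distrib)
      finally show ?thesis .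
    qed
    then show False using isoI B by blast
  qed
  have "of_int (int i - 1) \<le> real_of_int c" "real_of_int (c + 1) \<le> of_int (int i)"
    using la ub_le ua ub k0 by auto
  then have c: "c = int i - 1" by linarith
  then show "u a = real (fst l) - 1" "u b = real (fst l)" using ua ub k0 by (auto simp: l)
  have q: "0 \<le> real p / n" "real p / n \<le> 1" by (auto simp: n_def)
  have "a + real p / n * (b - a) \<in> {a..b}"
    using ab mult_right_mono[OF q(2), of "b - a"] mult_nonneg_nonneg[OF q(1), of "b - a"] by auto
  then show "u (a + real p / (real p + 1) * (b - a)) = real (fst l) - 1 + real p / (real p + 1)"
    using bspec[OF ck, of "a + real p / n * (b - a)"] ab c k0 by (simp add: l n_def)
qed

text \<open>The witness \<open>l\<close> is the first letter that breaks the interval.\<close>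

lemma break_point:
  assumes p: "p \<ge> 1" and I: "intact p u a b" and ab: "a < b"
    and B: "\<not> intact p (\<lambda>t. run p hs (u t)) a b"
  obtains h1 l h2 where "hs = h1 @ l # h2" "is_split l"
    "run p h1 (u a) = real (fst l) - 1" "run p h1 (u b) = real (fst l)"
  using I B
proof (induction hs arbitrary: u thesis)
  case (Cons l hs)
  show ?case
  proof (cases "intact p (\<lambda>t. move p l (u t)) a b")
    case True
    have B': "\<not> intact p (\<lambda>t. run p hs (move p l (u t))) a b" using Cons.prems(3) by simp
    obtain h1 l' h2 where "hs = h1 @ l' # h2" "is_split l'"
      "run p h1 (move p l (u a)) = real (fst l') - 1" "run p h1 (move p l (u b)) = real (fst l')"
      using Cons.IH[OF _ True B'] by metis
    then show ?thesis using Cons.prems(1)[of "l # h1" l' h2] by simp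
  next
    case False
    then show ?thesis
      using Cons.prems(1)[of "[]" l hs] intact_step[OF p Cons.prems(2) ab False] by simp
  qed
qed simp

section \<open>Residues and integer points\<close>

text \<open>These points form the residue class 0 in \<open>\<int>[1/(p+1)]\<close> modulo \<open>p\<close>.  As \<open>p + 1 \<equiv> 1\<close>, every letter
  preserves residues modulo \<open>p\<close>.  Thus a cell whose left end has residue 0 can be split by \<open>x\<^sub>1\<close> only, and
  only when its left end is exactly at the origin.\<close>

definition residue0 :: "nat \<Rightarrow> real \<Rightarrow> bool" where
  "residue0 p y \<longleftrightarrow> (\<exists>(c::int) (k::nat). y = real p * of_int c / (real p + 1) ^ k)"

lemma residue0_shift:
  assumes "residue0 p y"
  shows "residue0 p (y + real p * of_int z)"
proof -
  obtain c k where y: "y = real p * of_int c / (real p + 1) ^ k" using assms residue0_def by blast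
  have "y + real p * of_int z = real p * of_int (c + z * (int p + 1) ^ k) / (real p + 1) ^ k"
    unfolding y by (simp add: distrib_left add_divide_distrib add_nonneg_eq_0_iff)
  then show ?thesis unfolding residue0_def by blast
qed

lemma residue0_scale:
  assumes "residue0 p y"
  shows "residue0 p ((real p + 1) * y)" "residue0 p (y / (real p + 1))"
proof -
  obtain c k where y: "y = real p * of_int c / (real p + 1) ^ k" using assms residue0_def by blast
  have "(real p + 1) * y = real p * of_int ((int p + 1) * c) / (real p + 1) ^ k"
    unfolding y by (simp add: algebra_simps)
  then show "residue0 p ((real p + 1) * y)" unfolding residue0_def by blast
  have "y / (real p + 1) = real p * of_int c / (real p + 1) ^ Suc k"
    unfolding y by (simp add: mult.commute)
  then show "residue0 p (y / (real p + 1))" unfolding residue0_def by blast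
qed

lemma residue0_move:
  assumes "residue0 p y"
  shows "residue0 p (move p a y)"
proof (cases a)
  case (Pair i up)
  have s: "real i - 1 + (real p + 1) * (y - (real i - 1)) = (real p + 1) * y + real p * of_int (1 - int i)"
    by (simp add: algebra_simps)
  have j: "real i - 1 + (y - (real i - 1)) / (real p + 1) = (y + real p * of_int (int i - 1)) / (real p + 1)"
    by (simp add: field_simps)
  show ?thesis
    using assms residue0_shift[OF assms, of 1] residue0_shift[OF assms, of "- 1"]
      residue0_shift[OF residue0_scale(1)[OF assms], of "1 - int i"]
      residue0_scale(2)[OF residue0_shift[OF assms, of "int i - 1"]]
    unfolding Pair move.simps split_at_def join_at_def s j by auto
qed

lemma residue0_run: "residue0 p y \<Longrightarrow> residue0 p (run p hs y)"
  by (induction hs arbitrary: y) (auto simp: residue0_move)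

lemma residue0_int:
  assumes "residue0 p (real i)" "i < p"
  shows "i = 0"
proof -
  obtain c k where "real i = real p * of_int c / (real p + 1) ^ k" using assms(1) residue0_def by blast
  then have "real i * (real p + 1) ^ k = real p * of_int c"
    by (simp add: divide_simps add_nonneg_eq_0_iff split: if_splits)
  then have "of_int (int i * (int p + 1) ^ k) = (of_int (int p * c) :: real)" by simp
  then have "int i * (int p + 1) ^ k = int p * c" by (simp only: of_int_eq_iff)
  then have "int p dvd int i * (int p + 1) ^ k" by simp
  moreover have "coprime (int p) ((int p + 1) ^ k)"
    by (intro coprime_power_right_iff[THEN iffD2] disjI1) (simp add: coprime_iff_gcd_eq_1 gcd_add2)
  ultimately have "int p dvd int i" using coprime_dvd_mult_left_iff by blast
  then show ?thesis using assms(2) zdvd_imp_le by fastforce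
qed

lemma break_point0:
  assumes p: "p \<ge> 1" and I: "intact p u a b" and ab: "a < b"
    and B: "\<not> intact p (\<lambda>t. run p hs (u t)) a b"
    and v: "\<forall>l\<in>set hs. fst l \<le> p" and r: "residue0 p (u a)"
  obtains h1 l h2 where "hs = h1 @ l # h2" "run p h1 (u a) = 0" "run p h1 (u b) = 1"
proof -
  obtain h1 l h2 where h: "hs = h1 @ l # h2" "is_split l"
    "run p h1 (u a) = real (fst l) - 1" "run p h1 (u b) = real (fst l)"
    using break_point[OF p I ab B] by metis
  have l: "1 \<le> fst l" "fst l \<le> p" using h v by (auto simp: is_split_def)
  have "residue0 p (real (fst l - 1))"
    using residue0_run[OF r, of h1] h(3) l(1) by (simp add: of_nat_diff)
  then have "fst l - 1 = 0" using l p by (intro residue0_int) auto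
  then have "fst l = 1" using l by simp
  then show ?thesis using that h by simp
qed

lemma move_Ints:
  assumes "y \<in> \<int>" "\<not> is_join a"
  shows "move p a y \<in> \<int>"
proof (cases a)
  case (Pair i up)
  have "real i - 1 + (real p + 1) * (y - (real i - 1)) \<in> \<int>"
    using assms(1) by (intro Ints_add Ints_mult Ints_diff) auto
  then show ?thesis using assms by (auto simp: Pair split_at_def is_join_def)
qed

lemma run_Ints: "y \<in> \<int> \<Longrightarrow> joins hs = 0 \<Longrightarrow> run p hs y \<in> \<int>"
  by (induction hs arbitrary: y) (auto simp: move_Ints split: if_splits)

text \<open>Once a point is at a nonpositive integer it stays at such integers until the line is moved to the
  right, whatever is joined or split meanwhile.\<close>

lemma run_nonpos_Ints:
  "y \<in> \<int> \<Longrightarrow> y \<le> 0 \<Longrightarrow> rights hs = 0 \<Longrightarrow> run p hs y \<in> \<int> \<and> run p hs y \<le> 0"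
proof (induction hs arbitrary: y)
  case (Cons a hs)
  have "move p a y \<in> \<int> \<and> move p a y \<le> 0"
  proof (cases "fst a = 0")
    case True
    then have "a = (0, False)" using Cons.prems by (cases a) (auto split: if_splits)
    then show ?thesis using Cons.prems by auto
  next
    case False
    then show ?thesis using Cons.prems move_nonpos by simp
  qed
  then show ?case using Cons by (auto split: if_splits)
qed simp

lemma run_pos: "y > 0 \<Longrightarrow> lefts hs = 0 \<Longrightarrow> run p hs y > 0"
proof (induction hs arbitrary: y)
  case (Cons a hs)
  have "move p a y > 0"
  proof (cases "fst a = 0")
    case True
    then have "a = (0, True)" using Cons.prems by (cases a) (auto split: if_splits)
    then show ?thesis using Cons.prems by auto
  next
    case False
    then show ?thesis using Cons.prems move_pos by simp
  qed
  then show ?case using Cons by (auto split: if_splits)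
qed simp

section \<open>The price of joins\<close>

lemma run_Nil: "run p [] = (\<lambda>t. t)"
  by auto

text \<open>Let \<open>\<I>\<close> be a set of intervals that start between \<open>P\<close> and \<open>Q\<close> and whose last part \<open>Q\<close> does not precede.
  The split that breaks such an interval moves \<open>Q\<close> one block further and leaves \<open>P\<close> in its place.  So the
  distance in blocks from \<open>P\<close> to \<open>Q\<close>, minus the number of broken intervals, drops by at most one
  at each join and never at another letter.\<close>

lemma potential_run:
  assumes p: "p \<ge> 1" and fin: "finite \<I>" and inj: "inj_on fst \<I>"
    and \<I>: "\<And>a b. (a, b) \<in> \<I> \<Longrightarrow> P \<le> a \<and> a < b \<and> a + real p / (real p + 1) * (b - a) \<le> Q"
    and PQ: "P < Q" and v: "\<forall>l\<in>set hs. fst l \<le> p"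
  shows "block p (run p hs Q) - block p (run p hs P) - int (card {(a, b) \<in> \<I>. \<not> intact p (run p hs) a b})
     \<ge> block p Q - block p P - int (card {(a, b) \<in> \<I>. \<not> intact p (\<lambda>t. t) a b}) - int (joins hs)"
  using v
proof (induction hs rule: rev_induct)
  case (snoc l hs)
  let ?u = "run p hs"
  let ?B = "\<lambda>u. {(a, b) \<in> \<I>. \<not> intact p u a b}"
  have [simp]: "run p (hs @ [l]) = (\<lambda>t. move p l (?u t))" by (auto simp: run_append)
  have lp: "fst l \<le> p" using snoc.prems by simp
  have finB: "finite (?B u)" for u by (rule finite_subset[OF _ fin]) auto
  have g: "block p (move p l (?u Q)) - block p (move p l (?u P)) \<ge> block p (?u Q) - block p (?u P) - (if is_join l then 1 else 0)"
    using gap_step[OF p lp run_less[OF PQ]] .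
  have "block p (move p l (?u Q)) - block p (move p l (?u P)) - int (card (?B (\<lambda>t. move p l (?u t))))
     \<ge> block p (?u Q) - block p (?u P) - int (card (?B ?u)) - (if is_join l then 1 else 0)"
  proof (cases "?B (\<lambda>t. move p l (?u t)) \<subseteq> ?B ?u")
    case True
    then show ?thesis using g card_mono[OF finB True] by simp
  next
    case False
    then obtain a b where ab: "(a, b) \<in> \<I>" "intact p ?u a b" "\<not> intact p (\<lambda>t. move p l (?u t)) a b" by auto
    note I = \<I>[OF ab(1)]
    note S = intact_step[OF p ab(2) _ ab(3)]
    have a: "is_split l" "?u a = real (fst l) - 1" using S I by auto
    \<comment> \<open>a split affects one cell, and the intervals have different left ends, so only one breaks\<close>
    have "?B (\<lambda>t. move p l (?u t)) \<subseteq> insert (a, b) (?B ?u)"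
    proof (rule subsetI, rule ccontr)
      fix x assume x: "x \<in> ?B (\<lambda>t. move p l (?u t))" "x \<notin> insert (a, b) (?B ?u)"
      obtain a' b' where x': "x = (a', b')" by (cases x)
      have 1: "(a', b') \<in> \<I>" "\<not> intact p (\<lambda>t. move p l (?u t)) a' b'" "intact p ?u a' b'"
        using x by (auto simp: x')
      then have "?u a' = ?u a" using intact_step(2)[OF p, of ?u a' b' l] \<I>[OF 1(1)] a by auto
      then have "a' = a" using run_strict_mono strict_mono_eq by blast
      moreover then have "b' = b" using inj_onD[OF inj, of "(a', b')" "(a, b)"] ab(1) 1(1) by simp
      ultimately show False using x by (simp add: x')
    qed
    then have "card (?B (\<lambda>t. move p l (?u t))) \<le> card (insert (a, b) (?B ?u))"
      using finB by (intro card_mono) auto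
    also have "\<dots> \<le> Suc (card (?B ?u))" using card_insert_le_m1 by (simp add: card_insert_if finB)
    finally have c: "card (?B (\<lambda>t. move p l (?u t))) \<le> Suc (card (?B ?u))" .
    obtain i where l: "l = (i, True)" "i \<noteq> 0" using a(1) by (cases l) (auto simp: is_split_def)
    have "?u (a + real p / (real p + 1) * (b - a)) \<le> ?u Q"
      using I run_strict_mono strict_mono_less_eq by blast
    then have "block p (move p l (?u Q)) \<ge> block p (?u Q) + 1"
      using S(4) I l lp split_at_block[OF p, of i "?u Q"] by auto
    moreover have "?u P \<le> ?u a" using I run_strict_mono strict_mono_less_eq by blast
    then have "move p l (?u P) = ?u P" using a l by (simp add: split_at_def)
    moreover have "\<not> is_join l" using l by (simp add: is_join_def)
    ultimately show ?thesis using c by simp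
  qed
  then show ?case using snoc.IH snoc.prems by (auto split: if_splits)
qed (simp add: run_Nil)

section \<open>The bound on the travel\<close>

text \<open>The left ends of the nested intervals \<open>[comb p j, 1]\<close>, each of which is the last of the \<open>p + 1\<close> parts of
  its predecessor, starting from the cell \<open>[0, 1]\<close>.\<close>

definition comb :: "nat \<Rightarrow> nat \<Rightarrow> real" where
  "comb p j = 1 - 1 / (real p + 1) ^ j"

lemma comb_0 [simp]: "comb p 0 = 0"
  by (simp add: comb_def)

lemma comb_less_1: "comb p j < 1"
  by (simp add: comb_def add_nonneg_pos)

lemma comb_Suc: "comb p (Suc j) = comb p j + real p / (real p + 1) * (1 - comb p j)"
proof -
  have "1 / (real p + 1) ^ Suc j = 1 / (real p + 1) ^ j - real p / (real p + 1) * (1 / (real p + 1) ^ j)"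
    by (simp add: divide_simps add_nonneg_eq_0_iff)
  then show ?thesis by (simp add: comb_def)
qed

lemma comb_less: "p \<ge> 1 \<Longrightarrow> i < j \<Longrightarrow> comb p i < comb p j"
  unfolding comb_def by (simp add: frac_less2 power_strict_increasing)

lemma comb_le: "p \<ge> 1 \<Longrightarrow> i \<le> j \<Longrightarrow> comb p i \<le> comb p j"
  using comb_less[of p i j] by (cases "i = j") auto

lemma comb_nonneg: "p \<ge> 1 \<Longrightarrow> 0 \<le> comb p j"
  using comb_le[of p 0 j] by simp

lemma residue0_comb: "residue0 p (comb p j)"
proof -
  have "(int p) dvd (int p + 1) ^ j - 1"
    by (cases "j = 0") (simp_all add: power_diff_1_eq)
  then obtain c where "(int p + 1) ^ j - 1 = int p * c" by (elim dvdE)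
  then have "real_of_int ((int p + 1) ^ j - 1) = of_int (int p * c)" by simp
  then have "comb p j = real p * of_int c / (real p + 1) ^ j"
    by (simp add: comb_def divide_simps add_nonneg_eq_0_iff)
  then show ?thesis unfolding residue0_def by blast
qed

lemma intact_comb: "intact p (\<lambda>t. t) (comb p j) 1"
  unfolding intact_def
proof (intro exI ballI)
  fix t
  show "t = (of_int ((int p + 1) ^ j - 1) + (t - comb p j) / (1 - comb p j)) / (real p + 1) ^ j"
    by (simp add: comb_def divide_simps add_nonneg_eq_0_iff)
qed

lemma intact_cell: "intact p (\<lambda>t. t) (of_int z) (of_int z + 1)"
  unfolding intact_def by (intro exI[of _ z] exI[of _ 0]) simp

text \<open>The last comb interval is split when its left end \<open>Q\<close> is at the origin (\<open>h1\<close> is the word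
  before this split), and the cell at \<open>P\<close> is split when \<open>P\<close> is there.  Up to the first of these two
  times, between them, and after the second one, the depth of \<open>P\<close> changes by known amounts; they involve
  \<open>G\<close>, the distance from \<open>P\<close> to \<open>Q\<close> at the time when \<open>Q\<close> is at the origin.  All other comb intervals are broken
  at that time, so \<open>potential_run\<close> bounds \<open>G\<close> from below.  The order of the two splits decides whether
  \<open>+l\<close> or \<open>-l\<close> enters the bound.

  In the second claim, the word leaves the line such that a particular point \<open>y\<close> is not at an integer.
  In case of equality in the first claim there is no move to the right on the way to the comb's
  end, counted from the split at \<open>P\<close> if that comes first, and there is no join afterwards.  The point \<open>y\<close> is at a nonpositive integer either from the
  beginning or from the time when its comb interval is broken, so it is at an integer when \<open>Q\<close>
  reaches the origin, and stays at integers from then on.\<close>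

theorem travel_bound:
  fixes l :: int
  assumes p: "p \<ge> 1" and m: "m \<ge> 1" and v: "\<forall>h\<in>set hs. fst h \<le> p"
    and end_P: "run p hs (- real (p * m)) = real p * of_int (l - int m - 1)"
    and brk_P: "\<not> intact p (run p hs) (- real (p * m)) (- real (p * m) + 1)"
    and brk_Q: "\<not> intact p (run p hs) (comb p m) 1"
    and l: "\<bar>l\<bar> \<le> int m + 1"
  shows "int (rights hs + lefts hs + 2 * joins hs) \<ge> 4 * int m + 1 - \<bar>l\<bar>" (is ?A)
    and "\<bar>l\<bar> \<le> int m - 2 \<Longrightarrow>
      run p hs (if l \<le> 0 then comb p (nat (1 - l)) else real p * of_int (1 - l)) \<notin> \<int> \<Longrightarrow>
      int (rights hs + lefts hs + 2 * joins hs) \<ge> 4 * int m + 2 - \<bar>l\<bar>" (is "_ \<Longrightarrow> _ \<Longrightarrow> ?B")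
proof -
  define P where "P = - real (p * m)"
  define Q where "Q = comb p m"
  define y where "y = (if l \<le> 0 then comb p (nat (1 - l)) else real p * of_int (1 - l))"
  note [simp] = run_append
  have p0: "real p > 0" using p by simp
  have Q: "0 < Q" "Q < 1" using comb_less[OF p, of 0 m] m comb_less_1 by (auto simp: Q_def)
  have "P \<le> 0" by (simp add: P_def)
  then have PQ: "P < Q" using Q by linarith
  have P1: "P + 1 \<le> 0" using p m mult_le_mono[of 1 p 1 m] by (simp add: P_def del: of_nat_mult)
  have resP: "residue0 p P" unfolding residue0_def P_def
    by (rule exI[of _ "- int m"], rule exI[of _ 0]) simp
  have bP: "block p P = - int m"
  proof -
    have "P / real p = of_int (- int m)" using p0 by (simp add: P_def)
    then show ?thesis unfolding block_def by (simp only: floor_of_int)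
  qed
  have dP: "depth p P = - int m" using bP by (simp add: depth_def)
  have dend: "depth p (run p hs P) = l - int m - 1"
  proof -
    have "run p hs P / real p = of_int (l - int m - 1)" using end_P p0 by (simp add: P_def)
    then have "block p (run p hs P) = l - int m - 1" unfolding block_def by (simp only: floor_of_int)
    then show ?thesis using l by (simp add: depth_def)
  qed
  have z0: "depth p 0 = 0" by (simp add: depth_def block_def)
  have P_int: "P = of_int (- int (p * m))" by (simp add: P_def)
  have intP: "intact p (\<lambda>t. t) P (P + 1)"
    unfolding P_int by (rule intact_cell)
  obtain h1 a h2 where h: "hs = h1 @ a # h2" and uQ: "run p h1 Q = 0" and u1: "run p h1 1 = 1"
    using break_point0[OF p intact_comb comb_less_1 brk_Q v residue0_comb] unfolding Q_def by metis
  define u where "u = run p h1"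
  have v1: "\<forall>h\<in>set h1. fst h \<le> p" and v2: "\<forall>h\<in>set (a # h2). fst h \<le> p" using v h by auto
  \<comment> \<open>the last comb interval fills a cell, so the images of the longer ones are longer than a cell\<close>
  have all_broken: "\<not> intact p u (comb p j) 1" if "j < m" for j
  proof
    assume "intact p u (comb p j) 1"
    then have "u 1 - u (comb p j) \<le> 1" using intact_length comb_less_1 by blast
    moreover have "u (comb p j) < u Q" using run_less comb_less[OF p that] by (simp add: u_def Q_def)
    ultimately show False using uQ u1 by (simp add: u_def)
  qed
  define G where "G = - block p (u P)"
  have "u P < 0" using run_less[OF PQ, of p h1] uQ by (simp add: u_def)
  then have G0: "depth p (u P) = - G"
    using block_mono[of "u P" 0 p] by (simp add: depth_def G_def block_def)
  define \<I> where "\<I> = insert (P, P + 1) ((\<lambda>j. (comb p j, 1)) ` {..<m})"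
  have combP: "comb p j > P" for j using comb_nonneg[OF p, of j] P1 by linarith
  have inj_comb: "inj_on (\<lambda>j. (comb p j, 1::real)) {..<m}"
    using comb_less[OF p] by (auto intro!: inj_onI) (metis less_irrefl nat_neq_iff)
  have fin: "finite \<I>" by (simp add: \<I>_def)
  have injI: "inj_on fst \<I>" using combP by (auto simp: \<I>_def inj_on_def)
  have IP: "P \<le> a \<and> a < b \<and> a + real p / (real p + 1) * (b - a) \<le> Q" if "(a, b) \<in> \<I>" for a b
  proof (cases "(a, b) = (P, P + 1)")
    case True
    have "real p / (real p + 1) \<le> 1" by simp
    then have "P + real p / (real p + 1) \<le> Q" using P1 Q by linarith
    then show ?thesis using True P1 Q by auto
  next
    case False
    then have "(a, b) \<in> (\<lambda>j. (comb p j, 1)) ` {..<m}" using that unfolding \<I>_def by blast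
    then obtain j where "j < m" "a = comb p j" "b = 1" by auto
    then show ?thesis using combP[of j] comb_less_1 comb_Suc[of p j] comb_le[OF p, of "Suc j" m]
      by (auto simp: Q_def)
  qed
  have c0: "{(a, b) \<in> \<I>. \<not> intact p (\<lambda>t. t) a b} = {}"
    using intact_comb intP by (auto simp: \<I>_def)
  have bQ: "block p Q = 0" "block p (u Q) = 0" using Q p uQ by (auto intro!: block_eq_0 simp: u_def)
  have pot: "G \<ge> int m + int (card {(a, b) \<in> \<I>. \<not> intact p u a b}) - int (joins h1)"
    using potential_run[OF p fin injI IP PQ v1] bP bQ unfolding c0 by (simp add: G_def u_def)
  have finB: "finite {(a, b) \<in> \<I>. \<not> intact p u a b}" by (rule finite_subset[OF _ fin]) auto
  have card_comb: "card ((\<lambda>j. (comb p j, 1::real)) ` {..<m}) = m"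
    using card_image[OF inj_comb] by simp
  have d1: "- G \<ge> - int m - int (lefts h1)"
    using depth_run[OF p, of h1 P] dP G0 by (simp add: u_def)
  have hs_eq: "run p hs t = run p (a # h2) (u t)" for t by (simp add: h u_def)
  have y_neg: "y \<in> \<int> \<and> y \<le> 0" if "l > 0"
    using that by (auto simp: y_def mult_nonneg_nonpos)
  have y_comb: "\<exists>g1 g2. h0 = g1 @ g2 \<and> run p g1 (w y) = 0"
    if asm: "l \<le> 0" "\<bar>l\<bar> \<le> int m - 2" "intact p w (comb p (nat (1 - l))) 1" "h1 = h3 @ h0" "w = run p h3" for h3 h0 w
  proof -
    have v0: "\<forall>h\<in>set h0. fst h \<le> p" using v1 asm(4) by simp
    have "\<not> intact p (\<lambda>t. run p h0 (w t)) (comb p (nat (1 - l))) 1"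
    proof -
      have "nat (1 - l) < m" using asm(1,2) by linarith
      moreover have "(\<lambda>t. run p h0 (w t)) = u" using asm(4,5) by (simp add: u_def fun_eq_iff)
      ultimately show ?thesis using all_broken by simp
    qed
    then obtain g1 c g2 where "h0 = g1 @ c # g2" "run p g1 (w (comb p (nat (1 - l)))) = 0"
      using break_point0[OF p asm(3) comb_less_1 _ v0] residue0_run[OF residue0_comb] asm(5) by metis
    then show ?thesis using asm(1) by (auto simp: y_def)
  qed
  have "?A \<and> (\<bar>l\<bar> \<le> int m - 2 \<longrightarrow> run p hs y \<notin> \<int> \<longrightarrow> ?B)"
  proof (cases "intact p u P (P + 1)")
    case True
    \<comment> \<open>the right job comes first: \<open>P\<close> goes left to depth \<open>-G\<close>, right to the origin, and left to its final place\<close>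
    have "\<not> intact p (\<lambda>t. run p (a # h2) (u t)) P (P + 1)"
      using brk_P unfolding hs_eq[symmetric] P_def by simp
    then obtain h3 b h4 where h34: "a # h2 = h3 @ b # h4" and u3: "run p h3 (u P) = 0"
      using break_point0[OF p True _ _ v2] residue0_run[OF resP] unfolding u_def
      by (metis less_add_one)
    have hs4: "hs = h1 @ h3 @ b # h4" using h h34 by simp
    have "(\<lambda>j. (comb p j, 1)) ` {..<m} \<subseteq> {(a, b) \<in> \<I>. \<not> intact p u a b}"
      using all_broken by (auto simp: \<I>_def)
    from card_mono[OF finB this] have "m \<le> card {(a, b) \<in> \<I>. \<not> intact p u a b}"
      by (simp only: card_comb)
    then have G: "G \<ge> 2 * int m - int (joins h1)" using pot by simp
    have d2: "0 \<le> - G + int (rights h3)"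
      using depth_run[OF p, of h3 "u P"] G0 unfolding u3 z0 by linarith
    have d3: "l - int m - 1 \<ge> - int (lefts (b # h4))"
    proof -
      have e: "run p hs P = run p (b # h4) 0" using u3 by (simp add: hs4 u_def)
      show ?thesis using depth_run[OF p, of "b # h4" 0] dend unfolding e z0 by linarith
    qed
    have count: "rights hs = rights h1 + rights h3 + rights (b # h4)"
      "lefts hs = lefts h1 + lefts h3 + lefts (b # h4)"
      "joins hs = joins h1 + joins (a # h2)"
      unfolding hs4 by (simp_all add: h34)
    have bound: "int (rights hs + lefts hs + 2 * joins hs) \<ge> 4 * int m + 1 - l + int (rights h1) + 2 * int (joins (a # h2))"
      using G d1 d2 d3 count by linarith
    have "?B" if lm: "\<bar>l\<bar> \<le> int m - 2" and y: "run p hs y \<notin> \<int>"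
    proof (rule ccontr)
      assume "\<not> ?B"
      then have t: "rights h1 = 0" "joins (a # h2) = 0" "l \<ge> 0" using bound by linarith+
      have "u y \<in> \<int>"
      proof (cases "l > 0")
        case True
        then show ?thesis using run_nonpos_Ints[OF _ _ t(1)] y_neg by (simp add: u_def)
      next
        case False
        then obtain g1 g2 where g: "h1 = g1 @ g2" "run p g1 y = 0"
          using y_comb[of "\<lambda>t. t" "[]" h1, OF _ lm intact_comb _ run_Nil[symmetric]] by auto
        then show ?thesis using run_nonpos_Ints[of 0 g2 p] t(1) by (simp add: u_def)
      qed
      then show False using run_Ints[OF _ t(2)] y hs_eq by metis
    qed
    then show ?thesis using bound by auto
  next
    case False
    then obtain h3 b h4 where h34: "h1 = h3 @ b # h4" and u3: "run p h3 P = 0"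
      using break_point0[OF p intP _ _ v1 resP] unfolding u_def by (metis less_add_one)
    \<comment> \<open>the left job comes first, so the cell at \<open>P\<close> is broken as well and adds one to \<open>G\<close>\<close>
    let ?C = "insert (P, P + 1) ((\<lambda>j. (comb p j, 1)) ` {..<m})"
    have notin: "(P, P + 1) \<notin> (\<lambda>j. (comb p j, 1)) ` {..<m}"
    proof
      assume "(P, P + 1) \<in> (\<lambda>j. (comb p j, 1)) ` {..<m}"
      then obtain j where "P = comb p j" by blast
      then show False using combP[of j] by simp
    qed
    have card_C: "card ?C = Suc m"
      using card_comb by (simp only: card_insert_disjoint[OF _ notin] finite_imageI finite_lessThan)
    have "?C \<subseteq> {(a, b) \<in> \<I>. \<not> intact p u a b}"
      using all_broken False by (auto simp: \<I>_def)
    from card_mono[OF finB this] have "Suc m \<le> card {(a, b) \<in> \<I>. \<not> intact p u a b}"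
      by (simp only: card_C)
    then have G: "G \<ge> 2 * int m + 1 - int (joins h1)" using pot by simp
    have d1: "0 \<le> - int m + int (rights h3)"
      using depth_run[OF p, of h3 P] dP unfolding u3 z0 by linarith
    have d2: "- G \<ge> - int (lefts (b # h4))"
    proof -
      have e: "u P = run p (b # h4) 0" using u3 by (simp add: h34 u_def)
      show ?thesis using depth_run[OF p, of "b # h4" 0] G0 unfolding e z0 by linarith
    qed
    have d3: "l - int m - 1 \<le> - G + int (rights (a # h2))"
      using depth_run[OF p, of "a # h2" "u P"] dend G0 unfolding hs_eq[of P] by linarith
    have count: "rights hs = rights h3 + rights (b # h4) + rights (a # h2)"
      "lefts hs = lefts h3 + lefts (b # h4) + lefts (a # h2)"
      "joins hs = joins h1 + joins (a # h2)"
      unfolding h by (simp_all add: h34)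
    have bound: "int (rights hs + lefts hs + 2 * joins hs) \<ge> 4 * int m + 1 + l + int (lefts h3) + int (rights (b # h4)) + 2 * int (joins (a # h2))"
      using G d1 d2 d3 count by linarith
    have "?B" if lm: "\<bar>l\<bar> \<le> int m - 2" and y: "run p hs y \<notin> \<int>"
    proof (rule ccontr)
      assume "\<not> ?B"
      then have t: "lefts h3 = 0" "rights (b # h4) = 0" "joins (a # h2) = 0" "l \<le> 0"
        using bound by linarith+
      have y0: "y > 0" using t(4) comb_less[OF p, of 0 "nat (1 - l)"] by (simp add: y_def)
      \<comment> \<open>on the way to the left job the line is never moved to the left, so \<open>y\<close> stays positive and its comb interval cannot break\<close>
      have int3: "intact p (run p h3) (comb p (nat (1 - l))) 1"
      proof (rule ccontr)
        assume B: "\<not> ?thesis"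
        have v3: "\<forall>h\<in>set h3. fst h \<le> p" using v1 h34 by simp
        obtain g1 c g2 where "h3 = g1 @ c # g2" "run p g1 (comb p (nat (1 - l))) = 0"
          using break_point0[OF p intact_comb comb_less_1 B v3 residue0_comb] by blast
        then have "h3 = g1 @ c # g2" "run p g1 y = 0" using t(4) by (simp_all add: y_def)
        then show False using run_pos[OF y0, of g1 p] t(1) by simp
      qed
      obtain g1 g2 where g: "b # h4 = g1 @ g2" "run p g1 (run p h3 y) = 0"
        using y_comb[OF t(4) lm int3 h34 refl] by auto
      have "rights g2 = 0" using t(2) unfolding g(1) by simp
      then have "u y \<in> \<int>" using run_nonpos_Ints[of 0 g2 p] g(2) by (simp add: u_def h34 g(1))
      then show False using run_Ints[OF _ t(3)] y hs_eq by metis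
    qed
    then show ?thesis using bound by auto
  qed
  then show ?A and "\<bar>l\<bar> \<le> int m - 2 \<Longrightarrow>
      run p hs (if l \<le> 0 then comb p (nat (1 - l)) else real p * of_int (1 - l)) \<notin> \<int> \<Longrightarrow> ?B"
    unfolding y_def by blast+
qed

section \<open>The difference between splits and joins\<close>

lemma run_far_right:
  assumes p: "p \<ge> 1" and v: "\<forall>h\<in>set hs. fst h \<le> p" and t: "t \<ge> real p * (real (length hs) + 2)"
  shows "run p hs t = t + real p * (real (rights hs) - real (lefts hs) + real (splits hs) - real (joins hs))"
  using v t
proof (induction hs arbitrary: t)
  case (Cons a hs)
  obtain i up where a: "a = (i, up)" by (cases a)
  have "real p * 2 \<le> real p * (real (length (a # hs)) + 1)" by (intro mult_left_mono) auto
  moreover have eq: "real p * (real (length (a # hs)) + 2) = real p * (real (length (a # hs)) + 1) + real p"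
    by (simp add: algebra_simps)
  ultimately have t: "real i + real p \<le> t" using Cons.prems by (auto simp: a)
  then have m: "move p a t = t + real p * (if up then 1 else -1) * (if i = 0 then -1 else 1) * (if i = 0 then -1 else 1)"
    by (auto simp: a split_at_cases join_at_cases)
  have "move p a t \<ge> t - real p" using m by auto
  then have "move p a t \<ge> real p * (real (length hs) + 2)"
    using Cons.prems eq by (simp add: algebra_simps)
  then have "run p hs (move p a t) = move p a t + real p * (real (rights hs) - real (lefts hs) + real (splits hs) - real (joins hs))"
    using Cons by simp
  then show ?case unfolding run.simps m
    by (cases "i = 0"; cases up; simp add: a is_split_iff is_join_iff algebra_simps)
qed simp

lemma run_far_left:
  assumes "t \<le> - (real p * real (length hs))"
  shows "run p hs t = t + real p * (real (rights hs) - real (lefts hs))"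
  using assms
proof (induction hs arbitrary: t)
  case (Cons a hs)
  obtain i up where a: "a = (i, up)" by (cases a)
  have eq: "real p * real (length (a # hs)) = real p * real (length hs) + real p"
    by (simp add: algebra_simps)
  moreover have "real p * real (length hs) \<ge> 0" by simp
  ultimately have t: "t \<le> 0" using Cons.prems by linarith
  then have m: "move p a t = t + (if i = 0 then real p * (if up then 1 else -1) else 0)"
    using move_nonpos[of a t p] by (auto simp: a)
  have "move p a t \<le> t + real p" using m by auto
  then have "move p a t \<le> - (real p * real (length hs))"
    using Cons.prems eq by simp
  then have "run p hs (move p a t) = move p a t + real p * (real (rights hs) - real (lefts hs))"
    using Cons by simp
  then show ?case unfolding run.simps m
    by (cases "i = 0"; cases up; simp add: a algebra_simps)
qed simp

text \<open>Near \<open>-\<infinity>\<close> only \<open>x\<^sub>0\<close> acts, and near \<open>\<infinity>\<close> every letter is a translation by \<open>p\<close> or \<open>-p\<close>.\<close>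

lemma exponent_unique:
  assumes p: "p \<ge> 1" and v: "\<forall>h\<in>set hs. fst h \<le> p" "\<forall>h\<in>set hs'. fst h \<le> p"
    and eq: "run p hs = run p hs'"
  shows "int (splits hs) - int (joins hs) = int (splits hs') - int (joins hs')"
proof -
  define M where "M = real p * (real (length hs) + real (length hs') + 2)"
  have nn: "0 \<le> real p * real (length hs)" "0 \<le> real p * real (length hs')" by simp_all
  have M: "real p * (real (length hs) + 2) \<le> M" "real p * (real (length hs') + 2) \<le> M"
    "- M \<le> - (real p * real (length hs))" "- M \<le> - (real p * real (length hs'))"
    using nn unfolding M_def distrib_left by linarith+
  have "real p * (real (rights hs) - real (lefts hs) + real (splits hs) - real (joins hs))
      = real p * (real (rights hs') - real (lefts hs') + real (splits hs') - real (joins hs'))"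
    using run_far_right[OF p v(1) M(1)] run_far_right[OF p v(2) M(2)] unfolding eq by linarith
  moreover have "real p * (real (rights hs) - real (lefts hs)) = real p * (real (rights hs') - real (lefts hs'))"
    using run_far_left[OF M(3)] run_far_left[OF M(4)] unfolding eq by linarith
  ultimately have "real (splits hs) - real (joins hs) = real (splits hs') - real (joins hs')"
    using p by simp
  then show ?thesis by linarith
qed

section \<open>The words of a seesaw element\<close>

text \<open>The left job.  One more step left than right puts the points to the right of the split cell back in
  place, so that the word acts trivially there.\<close>

definition visit_word :: "nat \<Rightarrow> letter list" where
  "visit_word m = replicate m (0, True) @ [(1, True)] @ replicate (Suc m) (0, False)"

text \<open>The right job: split the cell at the origin and bring the last part there, \<open>m\<close> times; split once
  more and return.\<close>

definition comb_word :: "nat \<Rightarrow> letter list" where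
  "comb_word m = concat (replicate m [(1, True), (0, False)]) @ [(1, True)] @ replicate m (0, True)"

definition power_word :: "int \<Rightarrow> letter list" where
  "power_word l = (if l \<ge> 0 then replicate (nat l) (0, True) else replicate (nat (- l)) (0, False))"

lemma run_rights: "run p (replicate k (0, True)) y = y + real p * real k"
  by (induction k arbitrary: y) (auto simp: algebra_simps)

lemma run_lefts: "run p (replicate k (0, False)) y = y - real p * real k"
  by (induction k arbitrary: y) (auto simp: algebra_simps)

lemma run_power: "run p (power_word l) y = y + real p * of_int l"
  by (auto simp: power_word_def run_rights run_lefts)

lemma run_visit:
  shows "t \<le> - real (p * m) \<Longrightarrow> run p (visit_word m) t = t - real p"
    and "- real (p * m) + 1 \<le> t \<Longrightarrow> run p (visit_word m) t = t"
  by (auto simp: visit_word_def run_append run_rights run_lefts split_at_cases algebra_simps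
      simp del: replicate.simps)

lemma run_comb_nonpos:
  assumes "t \<le> 0"
  shows "run p (comb_word m) t = t"
proof -
  have "run p (concat (replicate k [(1, True), (0, False)])) t = t - real p * real k" for k
    using assms
  proof (induction k arbitrary: t)
    case (Suc k)
    then show ?case using Suc.IH[of "t - real p"] by (simp add: split_at_cases algebra_simps)
  qed simp
  moreover have "0 \<le> real p * real m" by simp
  then have "t - real p * real m \<le> 0" using assms by linarith
  ultimately show ?thesis
    by (simp add: comb_word_def run_append run_rights split_at_cases)
qed

lemma split_comb:
  assumes p: "p \<ge> 1"
  shows "split_at p 1 (comb p (Suc j)) = comb p j + real p"
proof -
  have "split_at p 1 (comb p (Suc j)) = (real p + 1) * comb p (Suc j)"
    using comb_nonneg[OF p, of "Suc j"] comb_less_1[of p "Suc j"] by (simp add: split_at_cases)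
  also have "\<dots> = comb p j + real p"
    by (simp add: comb_def divide_simps add_nonneg_eq_0_iff) (simp add: algebra_simps)
  finally show ?thesis .
qed

lemma run_comb_comb:
  assumes p: "p \<ge> 1" and j: "j \<le> m"
  shows "run p (comb_word m) (comb p j) = real p * real j"
proof -
  have A: "run p (concat (replicate k [(1, True), (0, False)])) (comb p (k + i)) = comb p i" for k i
    by (induction k) (simp_all add: split_comb[OF p, simplified])
  have B: "run p (concat (replicate k [(1, True), (0, False)])) t = t - real p * real k" if "t \<le> 0" for k t
    using that
  proof (induction k arbitrary: t)
    case (Suc k)
    then show ?case using Suc.IH[of "t - real p"] by (simp add: split_at_cases algebra_simps)
  qed simp
  have "replicate m [(1, True), (0, False)] = replicate j [(1, True), (0, False)] @ replicate (m - j) [(1::nat, True), (0::nat, False)]"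
    using j by (simp add: replicate_add[symmetric])
  then have "run p (concat (replicate m [(1, True), (0, False)])) (comb p j) = 0 - real p * real (m - j)"
    using A[of j 0] B[of 0 "m - j"] by (simp add: run_append)
  moreover have "- (real p * real (m - j)) \<le> 0" by simp
  ultimately show ?thesis using j
    by (simp add: comb_word_def run_append run_rights split_at_cases of_nat_diff algebra_simps)
qed

lemma run_comb_1: "run p (comb_word m) 1 = real p * real m + real p + 1"
proof -
  have "run p (concat (replicate k [(1, True), (0, False)])) 1 = 1" for k
    by (induction k) (simp_all add: split_at_cases)
  then show ?thesis
    by (simp add: comb_word_def run_append run_rights split_at_cases)
qed

text \<open>The left job moves negative points only, and the right job moves positive points only.\<close>

lemma words_commute:
  assumes m: "m \<ge> 1" and p: "p \<ge> 1"
  shows "run p (visit_word m @ comb_word m) = run p (comb_word m @ visit_word m)"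
proof
  fix t
  have pm: "real (p * m) \<ge> 1" using assms mult_le_mono[of 1 p 1 m] by (simp del: of_nat_mult)
  have v0: "run p (visit_word m) 0 = 0" using run_visit(2) pm by simp
  show "run p (visit_word m @ comb_word m) t = run p (comb_word m @ visit_word m) t"
  proof (cases "t \<le> 0")
    case True
    then have "run p (visit_word m) t \<le> 0"
      using v0 run_strict_mono[of p "visit_word m"] by (metis strict_mono_less_eq)
    then show ?thesis using True by (simp add: run_append run_comb_nonpos)
  next
    case False
    then have "run p (comb_word m) t \<ge> 0"
      using run_comb_nonpos[of 0 p m] run_strict_mono[of p "comb_word m"] by (metis strict_mono_less_eq nle_le)
    then show ?thesis using False pm by (simp add: run_append run_visit(2))
  qed
qed

text \<open>Here \<open>tail\<close> is empty for the length of \<open>w x\<^sub>0\<^sup>l\<close>, and it consists of one letter other than \<open>x\<^sub>0\<close> and its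
  inverse for the second seesaw condition.  The cells split by the two jobs are far enough from the origin that
  the tail does not join them again.\<close>

lemma seesaw_lower_bound:
  fixes l :: int
  assumes p: "p \<ge> 1" and m: "m \<ge> 2" and v: "\<forall>h\<in>set hs. fst h \<le> p"
    and tail: "tail = [] \<and> \<bar>l\<bar> \<le> int m \<or> (\<exists>i up. tail = [(i, up)] \<and> 1 \<le> i \<and> i \<le> p \<and> \<bar>l\<bar> \<le> int m - 2)"
    and eq: "run p hs = run p (visit_word m @ comb_word m @ power_word l @ tail)"
  shows "int (length hs) \<ge> 5 * int m + 3 - \<bar>l\<bar>"
proof -
  define P where "P = - real (p * m)"
  have p0: "real p \<ge> 1" using p by simp
  have lm: "\<bar>l\<bar> \<le> int m" using tail by auto
  have base: "run p hs t = run p tail (run p (comb_word m) (run p (visit_word m) t) + real p * of_int l)" for t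
    by (simp add: eq run_append run_power)
  have "real (p * m) \<ge> 1" using p m mult_le_mono[of 1 p 1 m] by (simp del: of_nat_mult)
  then have P1: "P + 1 \<le> 0" by (simp add: P_def)
  have val_P: "run p hs P = run p tail (real p * of_int (l - int m - 1))"
    using P1 by (simp add: base run_visit(1) run_comb_nonpos P_def algebra_simps)
  have val_nonpos: "run p hs t = run p tail (t + real p * of_int l)" if "P + 1 \<le> t" "t \<le> 0" for t
    using that by (simp add: base run_visit(2) run_comb_nonpos P_def)
  have val_comb: "run p hs (comb p j) = run p tail (real p * of_int (int j + l))" if "j \<le> m" for j
    using P1 comb_nonneg[OF p, of j] that
    by (simp add: base run_visit(2) run_comb_comb[OF p] P_def algebra_simps)
  have val_1: "run p hs 1 = run p tail (real p * of_int (int m + l) + real p + 1)"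
    using P1 by (simp add: base run_visit(2) run_comb_1 P_def algebra_simps)
  have tail_neg: "run p tail t = t" if "t \<le> 0" for t
    using tail that move_nonpos by auto
  have end_P: "run p hs P = real p * of_int (l - int m - 1)"
    using val_P tail_neg[of "real p * of_int (l - int m - 1)"] lm by (simp add: mult_nonneg_nonpos)
  have end_P1: "run p hs (P + 1) = P + 1 + real p * of_int l" if "l < int m"
  proof -
    have "real p * 1 \<le> real p * of_int (int m - l)" using that by (intro mult_left_mono) auto
    then have "P + 1 + real p * of_int l \<le> 0" using p0 by (simp add: P_def algebra_simps)
    then show ?thesis using val_nonpos[OF order_refl P1] tail_neg by simp
  qed
  have brk_P: "\<not> intact p (run p hs) P (P + 1)"
  proof -
    have "run p hs (P + 1) = P + 1 + real p * of_int l"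
      using end_P1 val_nonpos[OF order_refl P1] tail lm by (cases "tail = []") auto
    then have "run p hs (P + 1) - run p hs P > 1"
      using end_P p0 by (simp add: P_def algebra_simps)
    then show ?thesis using intact_length[of p "run p hs" P "P + 1"] by auto
  qed
  have brk_Q: "\<not> intact p (run p hs) (comb p m) 1"
  proof -
    have "run p hs 1 - run p hs (comb p m) > 1"
    proof (cases "tail = []")
      case True
      then show ?thesis using val_1 val_comb[of m] p0 by simp
    next
      case False
      then obtain i up where i: "tail = [(i, up)]" "1 \<le> i" "i \<le> p" "\<bar>l\<bar> \<le> int m - 2" using tail by auto
      have "real p * 2 \<le> real p * of_int (int m + l)" using i by (intro mult_left_mono) auto
      moreover have "real i \<le> real p" using i by simp
      ultimately have "real i + real p \<le> real p * of_int (int m + l)" by linarith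
      then show ?thesis
        using val_1 val_comb[of m] p0 i by (cases up) (simp_all add: split_at_cases join_at_cases)
    qed
    then show ?thesis using intact_length[of p "run p hs" "comb p m" 1] comb_less_1[of p m] by auto
  qed
  have m1: "m \<ge> 1" and lm1: "\<bar>l\<bar> \<le> int m + 1" using m lm by auto
  note bounds = travel_bound[OF p m1 v end_P[unfolded P_def] brk_P[unfolded P_def] brk_Q lm1]
  have len: "int (length hs) = int (rights hs + lefts hs + 2 * joins hs) + (int (splits hs) - int (joins hs))"
    using length_letters[of hs] by simp
  have v': "\<forall>h\<in>set (visit_word m @ comb_word m @ power_word l @ tail). fst h \<le> p"
    using p tail by (auto simp: visit_word_def comb_word_def power_word_def)
  have cnt: "splits (concat (replicate k [(1, True), (0, False)])) = k"
    "joins (concat (replicate k [(1, True), (0, False)])) = 0" for k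
    by (induction k) (simp_all add: is_split_iff is_join_iff)
  have cnt0: "splits (replicate k (0, up)) = 0" "joins (replicate k (0, up)) = 0" for k up
    by (induction k) (simp_all add: is_split_iff is_join_iff)
  have exp: "int (splits hs) - int (joins hs) = int m + 2 + int (splits tail) - int (joins tail)"
    using exponent_unique[OF p v v' eq]
    by (simp add: visit_word_def comb_word_def power_word_def cnt[simplified] cnt0 is_split_iff is_join_iff del: replicate.simps)
  show ?thesis
  proof (cases "joins tail = 0")
    case True
    then show ?thesis using bounds(1) len exp by simp
  next
    case False
    then obtain i where i: "tail = [(i, False)]" "1 \<le> i" "i \<le> p" "\<bar>l\<bar> \<le> int m - 2"
      using tail by (auto simp: is_join_iff split: if_splits)
    \<comment> \<open>\<open>y\<close> is the point that is at \<open>p\<close> before the join; the join contracts \<open>[i-1, i+p]\<close>, whose interior contains \<open>p\<close>\<close>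
    define y where "y = (if l \<le> 0 then comb p (nat (1 - l)) else real p * of_int (1 - l))"
    have "run p hs y = join_at p i (real p)"
    proof (cases "l \<le> 0")
      case True
      then show ?thesis using val_comb[of "nat (1 - l)"] i by (simp add: y_def)
    next
      case False
      have "1 * 1 \<le> real p * of_int (int m - l + 1)" using i p0 by (intro mult_mono) auto
      then have "P + 1 \<le> y" using False p0 i(4) by (simp add: P_def y_def algebra_simps)
      moreover have "y \<le> 0" using False by (simp add: y_def mult_nonneg_nonpos)
      ultimately show ?thesis using val_nonpos[of y] i False by (simp add: y_def algebra_simps)
    qed
    moreover have "join_at p i (real p) = real i - 1 + (real p - (real i - 1)) / (real p + 1)"
      using i by (simp add: join_at_cases)
    moreover have "real i - 1 + (real p - (real i - 1)) / (real p + 1) \<notin> \<int>"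
    proof
      assume "real i - 1 + (real p - (real i - 1)) / (real p + 1) \<in> \<int>"
      then have "real i - 1 + (real p - (real i - 1)) / (real p + 1) - (real i - 1) \<in> \<int>"
        by (intro Ints_diff) auto
      then have "(real p - (real i - 1)) / (real p + 1) \<in> \<int>" by simp
      then obtain z :: int where z: "(real p - (real i - 1)) / (real p + 1) = of_int z" by (elim Ints_cases)
      have "0 < (real p - (real i - 1)) / (real p + 1)" "(real p - (real i - 1)) / (real p + 1) < 1"
        using i by (auto simp: divide_less_eq)
      then show False unfolding z by simp
    qed
    ultimately have "run p hs y \<notin> \<int>" by simp
    then have "int (rights hs + lefts hs + 2 * joins hs) \<ge> 4 * int m + 2 - \<bar>l\<bar>"
      using bounds(2) i unfolding y_def by blast
    then show ?thesis using len exp i by (simp add: is_split_iff is_join_iff)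
  qed
qed

section \<open>The chart of the interval\<close>

text \<open>A block \<open>[p b, p b + p]\<close> with \<open>b < 0\<close> is mapped to the interval from \<open>(p+1)\<close> to the power \<open>b - 1\<close> to \<open>(p+1)\<close>
  to the power \<open>b\<close>, and symmetrically at the other end of \<open>[0,1]\<close>, where the blocks start at \<open>p c - 1\<close>: the
  \<open>p - 1\<close> middle cells of length \<open>1/(p+1)\<close> lie between \<open>0\<close> and \<open>p - 1\<close>.\<close>

definition chart :: "nat \<Rightarrow> real \<Rightarrow> real" where
  "chart p y =
    (if y < 0
     then (real p + 1) powi (block p y - 1) * (1 + y - real p * of_int (block p y))
     else 1 - (real p + 1) powi (- block p (y + 1)) *
                (1 - (y + 1 - real p * of_int (block p (y + 1))) / (real p + 1)))"

lemma block_unique: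
  "p \<ge> 1 \<Longrightarrow> real p * of_int b \<le> y \<Longrightarrow> y < real p * of_int b + real p \<Longrightarrow> block p y = b"
  unfolding block_def by (simp add: floor_eq_iff field_simps)

lemma block_bounds:
  assumes "p \<ge> 1"
  shows "real p * of_int (block p y) \<le> y" "y < real p * of_int (block p y) + real p"
proof -
  have "of_int (block p y) \<le> y / real p" "y / real p < of_int (block p y) + 1"
    unfolding block_def by linarith+
  then show "real p * of_int (block p y) \<le> y" "y < real p * of_int (block p y) + real p"
    using assms by (simp_all add: field_simps)
qed

text \<open>The chart turns the translation by \<open>p\<close> into a homothety near each end: with centre 0 on the left and
  with centre 1 on the right.\<close>

lemma chart_shift_left:
  assumes p: "p \<ge> 1" and y: "y < 0"
  shows "chart p (y - real p) = chart p y / (real p + 1)"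
proof -
  have "(real p + 1) powi (block p y - 1 - 1) = (real p + 1) powi (block p y - 1) / (real p + 1)"
    by (subst power_int_diff) auto
  then show ?thesis using y by (simp add: chart_def block_shift[OF p] algebra_simps)
qed

lemma chart_shift_right:
  assumes p: "p \<ge> 1" and y: "y \<ge> 0"
  shows "1 - chart p (y + real p) = (1 - chart p y) / (real p + 1)"
proof -
  define b where "b = block p (y + 1)"
  define N r where "N = (real p + 1) powi (- b)" and "r = (y + 1 - real p * of_int b) / (real p + 1)"
  have b': "block p (y + real p + 1) = b + 1"
    using block_shift(1)[OF p, of "y + 1"] by (simp add: b_def add.commute add.left_commute)
  have N': "(real p + 1) powi (- (b + 1)) = N / (real p + 1)"
    unfolding N_def using power_int_diff[of "real p + 1" "- b" 1] by simp
  have r': "(y + real p + 1 - real p * of_int (b + 1)) / (real p + 1) = r"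
    unfolding r_def by (simp add: algebra_simps)
  have "chart p y = 1 - N * (1 - r)" using y by (simp add: chart_def b_def N_def r_def)
  moreover have "chart p (y + real p) = 1 - N / (real p + 1) * (1 - r)"
    using y unfolding chart_def b' N' r' by simp
  ultimately show ?thesis by simp
qed

lemma chart_mid:
  assumes p: "p \<ge> 1" and y: "0 \<le> y" "y \<le> real p - 1"
  shows "chart p y = (1 + y) / (real p + 1)"
proof (cases "y = real p - 1")
  case True
  then have "block p (y + 1) = 1" using p by (simp add: block_def)
  then show ?thesis using True y by (simp add: chart_def power_int_minus field_simps)
next
  case False
  then have "block p (y + 1) = 0" using y by (intro block_eq_0) auto
  then show ?thesis using y by (simp add: chart_def add.commute)
qed

lemma chart_left:
  assumes p: "p \<ge> 1" and y: "- real p \<le> y" "y \<le> 0"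
  shows "chart p y = (1 + y + real p) / (real p + 1) ^ 2"
proof (cases "y = 0")
  case True
  then show ?thesis using chart_mid[OF p, of 0] p by (simp add: power2_eq_square add.commute add_nonneg_eq_0_iff)
next
  case False
  then have "block p y = -1" using y p by (intro block_unique) auto
  moreover have "(real p + 1) powi (- 2) = 1 / (real p + 1) ^ 2"
    by (simp add: power_int_def inverse_eq_divide power_one_over)
  ultimately show ?thesis using False y by (simp add: chart_def)
qed

lemma chart_right:
  assumes p: "p \<ge> 1" and y: "real p - 1 \<le> y" "y \<le> 2 * real p - 1"
  shows "chart p y = real p / (real p + 1) + (y + 1 - real p) / (real p + 1) ^ 2"
proof -
  have "1 - chart p y = (1 - (y + 1 - real p) / (real p + 1)) / (real p + 1)"
  proof (cases "y \<ge> real p")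
    case True
    then have "1 - chart p y = (1 - chart p (y - real p)) / (real p + 1)"
      using chart_shift_right[OF p, of "y - real p"] by simp
    also have "chart p (y - real p) = (1 + (y - real p)) / (real p + 1)"
      using chart_mid[OF p, of "y - real p"] True y by simp
    finally show ?thesis by (simp add: algebra_simps)
  next
    case False
    have y0: "0 \<le> y" using p y by (auto intro: order_trans[of _ "real p - 1"])
    have "block p (y + 1) = 1" using False y p by (intro block_unique) auto
    then show ?thesis using y0 by (simp add: chart_def power_int_minus field_simps)
  qed
  then have "chart p y = 1 - (1 - (y + 1 - real p) / (real p + 1)) / (real p + 1)" by simp
  also have "\<dots> = real p / (real p + 1) + (y + 1 - real p) / (real p + 1) ^ 2"
  proof -
    have "1 - (1 - z / n) / n = (n - 1) / n + z / n ^ 2" if "n > 0" for z n :: real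
      using that by (simp add: field_simps power2_eq_square)
    from this[of "real p + 1"] show ?thesis by simp
  qed
  finally show ?thesis .
qed

lemma chart_neg_bounds:
  assumes p: "p \<ge> 1" and y: "y < 0"
  shows "(real p + 1) powi (block p y - 1) \<le> chart p y" "chart p y < (real p + 1) powi (block p y)"
proof -
  define N where "N = (real p + 1) powi (block p y - 1)"
  have N: "N > 0" by (simp add: N_def)
  have "(real p + 1) powi (block p y) = N * (real p + 1)"
    unfolding N_def by (subst power_int_diff) (auto simp: add_nonneg_eq_0_iff)
  moreover have "N * 1 \<le> N * (1 + y - real p * of_int (block p y))"
    using N block_bounds[OF p, of y] by (intro mult_left_mono) auto
  moreover have "N * (1 + y - real p * of_int (block p y)) < N * (real p + 1)"
    using N block_bounds[OF p, of y] by (intro mult_strict_left_mono) auto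
  ultimately show "N \<le> chart p y" "chart p y < (real p + 1) powi (block p y)"
    using y by (simp_all add: chart_def N_def)
qed

lemma chart_nonneg_bounds:
  assumes p: "p \<ge> 1" and y: "y \<ge> 0"
  shows "1 - (real p + 1) powi (- block p (y + 1)) \<le> chart p y"
    "chart p y < 1 - (real p + 1) powi (- block p (y + 1) - 1)"
proof -
  define N where "N = (real p + 1) powi (- block p (y + 1))"
  have N: "N > 0" by (simp add: N_def)
  define r where "r = (y + 1 - real p * of_int (block p (y + 1))) / (real p + 1)"
  have r: "0 \<le> r" "1 - r > 1 / (real p + 1)"
    using block_bounds[OF p, of "y + 1"] by (simp_all add: r_def field_simps)
  have "(real p + 1) powi (- block p (y + 1) - 1) = N * (1 / (real p + 1))"
    unfolding N_def by (subst power_int_diff) auto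
  moreover have "N * (1 - r) \<le> N * 1" using N r by (intro mult_left_mono) auto
  moreover have "N * (1 / (real p + 1)) < N * (1 - r)" using N r(2) by (intro mult_strict_left_mono) auto
  moreover have "chart p y = 1 - N * (1 - r)" using y by (simp add: chart_def N_def r_def)
  ultimately show "1 - N \<le> chart p y"
    "chart p y < 1 - (real p + 1) powi (- block p (y + 1) - 1)" by auto
qed

lemma chart_strict_mono:
  assumes p: "p \<ge> 1"
  shows "strict_mono (chart p)"
proof (rule strict_monoI)
  fix x y :: real assume xy: "x < y"
  have n1: "1 \<le> real p + 1" by simp
  consider "y < 0" | "x \<ge> 0" | "x < 0" "y \<ge> 0" by linarith
  then show "chart p x < chart p y"
  proof cases
    case 1
    show ?thesis
    proof (cases "block p x = block p y")
      case True
      then show ?thesis using 1 xy by (simp add: chart_def)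
    next
      case False
      then have "block p x \<le> block p y - 1" using block_mono[of x y p] xy by simp
      then have "(real p + 1) powi (block p x) \<le> (real p + 1) powi (block p y - 1)"
        by (intro power_int_increasing n1)
      then show ?thesis using chart_neg_bounds[OF p, of x] chart_neg_bounds[OF p, of y] 1 xy by simp
    qed
  next
    case 2
    show ?thesis
    proof (cases "block p (x + 1) = block p (y + 1)")
      case True
      have "(x + 1 - z) / (real p + 1) < (y + 1 - z) / (real p + 1)" for z
        using xy by (intro divide_strict_right_mono) auto
      then show ?thesis using 2 xy True by (simp add: chart_def)
    next
      case False
      then have "- block p (y + 1) \<le> - block p (x + 1) - 1" using block_mono[of "x + 1" "y + 1" p] xy by simp
      then have "(real p + 1) powi (- block p (y + 1)) \<le> (real p + 1) powi (- block p (x + 1) - 1)"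
        by (intro power_int_increasing n1)
      then show ?thesis using chart_nonneg_bounds[OF p, of x] chart_nonneg_bounds[OF p, of y] 2 xy by simp
    qed
  next
    case 3
    have "block p x < 0" using 3 p by (simp add: block_def divide_neg_pos)
    then have "(real p + 1) powi (block p x) \<le> (real p + 1) powi (- 1)"
      by (intro power_int_increasing n1) auto
    then have "chart p x < 1 / (real p + 1)"
      using chart_neg_bounds[OF p 3(1)] by (simp add: power_int_minus inverse_eq_divide)
    also have "1 / (real p + 1) \<le> chart p y"
    proof (cases "y \<le> real p - 1")
      case True
      then show ?thesis using 3 chart_mid[OF p, of y] by (simp add: divide_right_mono)
    next
      case False
      then have "block p (y + 1) \<ge> block p (0 + real p)" by (intro block_mono) auto
      then have "block p (y + 1) \<ge> 1" using block_shift(1)[OF p, of 0] by (simp add: block_def)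
      then have "(real p + 1) powi (- block p (y + 1)) \<le> (real p + 1) powi (- 1)"
        by (intro power_int_increasing n1) auto
      then have "chart p y \<ge> 1 - 1 / (real p + 1)"
        using chart_nonneg_bounds[OF p 3(2)] by (simp add: power_int_minus inverse_eq_divide)
      moreover have "1 / (real p + 1) \<le> 1 - 1 / (real p + 1)" using p by (simp add: field_simps)
      ultimately show ?thesis by linarith
    qed
    finally show ?thesis .
  qed
qed

lemma chart_range:
  assumes p: "p \<ge> 1"
  shows "0 < chart p y" "chart p y < 1"
proof -
  have "0 < chart p (- \<bar>y\<bar> - 1)"
    by (rule less_le_trans[OF _ chart_neg_bounds(1)[OF p]]) auto
  then show "0 < chart p y"
    using strict_monoD[OF chart_strict_mono[OF p], of "- \<bar>y\<bar> - 1" y] by linarith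
  have "0 < (real p + 1) powi (- block p (\<bar>y\<bar> + 1) - 1)" by simp
  then have "chart p \<bar>y\<bar> < 1" using chart_nonneg_bounds(2)[OF p, of "\<bar>y\<bar>"] by linarith
  then show "chart p y < 1"
    using strict_mono_less_eq[OF chart_strict_mono[OF p], of y "\<bar>y\<bar>"] by linarith
qed

lemma chart_surj:
  assumes p: "p \<ge> 1" and t: "0 < t" "t < 1"
  shows "\<exists>y. chart p y = t"
proof -
  define n where "n = real p + 1"
  have n: "n > 1" "n \<noteq> 0" "0 < n" using p by (auto simp: n_def)
  have ex: "\<exists>k. (1 / n) ^ Suc k < s" if s: "0 < s" for s
  proof -
    obtain k where "(1 / n) ^ k < s" using real_arch_pow_inv[OF s, of "1 / n"] n by auto
    moreover have "(1 / n) ^ Suc k \<le> (1 / n) ^ k" using n by (intro power_decreasing) auto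
    ultimately show ?thesis by (meson le_less_trans)
  qed
  show ?thesis
  proof (cases "t < 1 / n")
    case True
    define k where "k = (LEAST k. (1 / n) ^ Suc k \<le> t)"
    have k1: "(1 / n) ^ Suc k \<le> t"
      unfolding k_def by (rule LeastI_ex) (use ex[OF t(1)] in \<open>auto intro: less_imp_le\<close>)
    have "k \<noteq> 0" using k1 True by (intro notI) simp
    then obtain k' where k': "k = Suc k'" by (cases k) auto
    have k2: "t < (1 / n) ^ k"
    proof -
      have "k' < k" by (simp add: k')
      then have "\<not> (1 / n) ^ Suc k' \<le> t" unfolding k_def by (rule not_less_Least)
      then show ?thesis by (simp add: k' not_le)
    qed
    define r where "r = t * n ^ Suc k - 1"
    have r: "0 \<le> r" "r < real p"
    proof -
      show "0 \<le> r" using k1 n by (simp add: r_def power_one_over field_simps)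
      have "t * n ^ k * n < 1 * n" using k2 n
        by (intro mult_strict_right_mono) (auto simp: power_one_over field_simps)
      then show "r < real p" by (simp add: r_def n_def algebra_simps)
    qed
    define y where "y = real p * of_int (- int k) + r"
    have "real p * 1 \<le> real p * real k" using k' by (intro mult_left_mono) auto
    then have "r < real p * real k" using r by linarith
    then have y0: "y < 0" by (simp add: y_def)
    have b: "block p y = - int k" using r by (intro block_unique[OF p]) (auto simp: y_def)
    have "n powi (- int k - 1) = 1 / n ^ Suc k"
      using power_int_diff[of n "- int k" 1] n by (simp add: power_int_minus inverse_eq_divide mult.commute)
    then have "chart p y = t"
      using y0 b n by (simp add: chart_def n_def[symmetric] y_def r_def)
    then show ?thesis by blast
  next
    case False
    define s where "s = 1 - t"
    have s: "0 < s" "s < 1" using t by (auto simp: s_def)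
    define k where "k = (LEAST k. (1 / n) ^ Suc k < s)"
    have k1: "(1 / n) ^ Suc k < s"
      unfolding k_def by (rule LeastI_ex) (rule ex[OF s(1)])
    have k2: "s \<le> (1 / n) ^ k"
    proof (cases k)
      case (Suc k')
      then have "k' < k" by simp
      then have "\<not> (1 / n) ^ Suc k' < s" unfolding k_def by (rule not_less_Least)
      then show ?thesis using Suc by (simp add: not_less)
    qed (use s in simp)
    define r where "r = n * (1 - s * n ^ k)"
    have r: "0 \<le> r" "r < real p"
    proof -
      have "s * n ^ k \<le> 1" using k2 n by (simp add: power_one_over field_simps)
      then show "0 \<le> r" using n by (simp add: r_def)
      have "1 < s * n ^ k * n" using k1 n by (simp add: power_one_over field_simps)
      then show "r < real p" by (simp add: r_def n_def algebra_simps)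
    qed
    define y where "y = real p * of_int (int k) + r - 1"
    have y0: "y \<ge> 0"
    proof (cases k)
      case 0
      then show ?thesis using False n by (simp add: y_def r_def s_def field_simps)
    next
      case (Suc k')
      have "1 * 1 \<le> real p * real k" using p Suc by (intro mult_mono) auto
      then show ?thesis using r by (simp add: y_def)
    qed
    have b: "block p (y + 1) = int k" using r by (intro block_unique[OF p]) (auto simp: y_def)
    have "n powi (- int k) = 1 / n ^ k" by (simp add: power_int_minus inverse_eq_divide)
    moreover have "1 - r / n = s * n ^ k" using n by (simp add: r_def)
    ultimately have "chart p y = 1 - s"
      using y0 b n by (simp add: chart_def n_def[symmetric]) (simp add: y_def)
    then show ?thesis by (auto simp: s_def)
  qed
qed

section \<open>The generators in the chart\<close>

lemma bracket:
  fixes f :: "nat \<Rightarrow> real"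
  assumes "a < b" "f a \<le> t" "t \<le> f b"
  shows "\<exists>j\<ge>a. j < b \<and> f j \<le> t \<and> t \<le> f (Suc j)"
  using assms
proof (induction b)
  case (Suc b)
  show ?case
  proof (cases "t \<le> f b \<and> a < b")
    case True
    then show ?thesis using Suc less_Suc_eq by auto
  next
    case False
    then show ?thesis using Suc.prems by (intro exI[of _ b]) (auto simp: less_Suc_eq)
  qed
qed simp

lemma subdiv_map_piece:
  assumes i: "i < p" and ab: "a < b" "b \<le> 2 * p + 1" and t: "subdiv p p a \<le> t" "t \<le> subdiv p p b"
    and step: "\<And>j. a \<le> j \<Longrightarrow> j < b \<Longrightarrow>
       subdiv p i j + (t - subdiv p p j) / (subdiv p p (Suc j) - subdiv p p j) * (subdiv p i (Suc j) - subdiv p i j) = v"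
  shows "subdiv_map p i t = v"
proof -
  obtain j where j: "a \<le> j" "j < b" "subdiv p p j \<le> t" "t \<le> subdiv p p (Suc j)"
    using bracket[OF ab(1) t] by auto
  then show ?thesis using subdiv_map_eq[of i p j t] step[OF j(1,2)] i ab by simp
qed

lemma subdiv_source:
  "j \<le> p \<Longrightarrow> subdiv p p j = real j / (real p + 1)"
  "p \<le> j \<Longrightarrow> j \<le> 2 * p + 1 \<Longrightarrow> subdiv p p j = real p / (real p + 1) + (real j - real p) / (real p + 1) ^ 2"
  by (auto simp: subdiv_def of_nat_diff add.commute)

lemma subdiv_target:
  "j \<le> i \<Longrightarrow> subdiv p i j = real j / (real p + 1)"
  "i \<le> j \<Longrightarrow> j \<le> i + p + 1 \<Longrightarrow> subdiv p i j = real i / (real p + 1) + (real j - real i) / (real p + 1) ^ 2"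
  "i + p + 1 \<le> j \<Longrightarrow> subdiv p i j = (real j - real p) / (real p + 1)"
proof -
  show "j \<le> i \<Longrightarrow> subdiv p i j = real j / (real p + 1)"
    by (simp add: subdiv_def add.commute)
  show "i \<le> j \<Longrightarrow> j \<le> i + p + 1 \<Longrightarrow> subdiv p i j = real i / (real p + 1) + (real j - real i) / (real p + 1) ^ 2"
    by (auto simp: subdiv_def of_nat_diff add.commute)
  have "(real p + 1) / (real p + 1) ^ 2 = 1 / (real p + 1)" by (simp add: power2_eq_square add_nonneg_eq_0_iff)
  then show "i + p + 1 \<le> j \<Longrightarrow> subdiv p i j = (real j - real p) / (real p + 1)"
    by (cases "j = i + p + 1") (auto simp: subdiv_def of_nat_diff add.commute add_divide_distrib[symmetric])
qed

text \<open>The consecutive pairs of intervals with equal ratio of lengths form at most four affine pieces, of slopes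
  \<open>1\<close>, \<open>1/(p+1)\<close>, \<open>1\<close> and \<open>p + 1\<close>.\<close>

lemma subdiv_map_values:
  assumes i: "i < p"
  shows "0 \<le> t \<Longrightarrow> t \<le> real i / (real p + 1) \<Longrightarrow> subdiv_map p i t = t"
    and "real i / (real p + 1) \<le> t \<Longrightarrow> t \<le> real p / (real p + 1) \<Longrightarrow>
      subdiv_map p i t = real i / (real p + 1) + (t - real i / (real p + 1)) / (real p + 1)"
    and "real p / (real p + 1) \<le> t \<Longrightarrow> t \<le> real p / (real p + 1) + (real i + 1) / (real p + 1) ^ 2 \<Longrightarrow>
      subdiv_map p i t = t - real p / (real p + 1) + real i / (real p + 1) + (real p - real i) / (real p + 1) ^ 2"
    and "real p / (real p + 1) + (real i + 1) / (real p + 1) ^ 2 \<le> t \<Longrightarrow> t \<le> 1 \<Longrightarrow>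
      subdiv_map p i t = 1 - (real p + 1) * (1 - t)"
proof -
  define n where "n = real p + 1"
  have n: "n > 0" "n \<noteq> 0" "n ^ 2 \<noteq> 0" by (auto simp: n_def)
  have D: "subdiv p p (Suc j) - subdiv p p j = (if j < p then 1 / n else 1 / n ^ 2)" if "j \<le> 2 * p" for j
    using that by (simp add: subdiv_diff n_def add.commute)
  have R: "subdiv p i (Suc j) - subdiv p i j = (if j < i \<or> j > i + p then 1 / n else 1 / n ^ 2)" for j
    using i by (simp add: subdiv_diff n_def add.commute)
  note S = subdiv_source[of _ p, folded n_def]
  note T = subdiv_target(1)[of _ i p, folded n_def]
  show "subdiv_map p i t = t" if t: "0 \<le> t" "t \<le> real i / (real p + 1)"
  proof (cases "i = 0")
    case True
    then show ?thesis using t thompson_carrierD(5)[OF subdiv_map_in_carrier[of i p]] by simp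
  next
    case False
    show ?thesis
    proof (rule subdiv_map_piece[OF i, of 0 i])
      fix j assume j: "0 \<le> j" "j < i"
      then show "subdiv p i j + (t - subdiv p p j) / (subdiv p p (Suc j) - subdiv p p j) * (subdiv p i (Suc j) - subdiv p i j) = t"
        using i n by (simp add: D R S T)
    qed (use False t i in \<open>auto simp: subdiv_source add.commute\<close>)
  qed
  show "subdiv_map p i t = real i / (real p + 1) + (t - real i / (real p + 1)) / (real p + 1)"
    if t: "real i / (real p + 1) \<le> t" "t \<le> real p / (real p + 1)"
    unfolding n_def[symmetric]
  proof (rule subdiv_map_piece[OF i, of i p])
    fix j assume j: "i \<le> j" "j < p"
    have d: "subdiv p p (Suc j) - subdiv p p j = 1 / n" using D[of j] i j by simp
    have r: "subdiv p i (Suc j) - subdiv p i j = 1 / n ^ 2" using R[of j] i j by simp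
    have "subdiv p i j + (t - subdiv p p j) / (subdiv p p (Suc j) - subdiv p p j) * (subdiv p i (Suc j) - subdiv p i j)
       = real i / n + (real j - real i) / n ^ 2 + (t - real j / n) / (1 / n) * (1 / n ^ 2)"
      unfolding d r using S(1)[of j] subdiv_target(2)[of i j p, folded n_def] i j n by simp
    also have "\<dots> = real i / n + (t - real i / n) / n" using n by (simp add: field_simps power2_eq_square)
    finally show "subdiv p i j + (t - subdiv p p j) / (subdiv p p (Suc j) - subdiv p p j) * (subdiv p i (Suc j) - subdiv p i j)
       = real i / n + (t - real i / n) / n" .
  qed (use t i in \<open>auto simp: subdiv_source add.commute\<close>)
  show "subdiv_map p i t = t - real p / (real p + 1) + real i / (real p + 1) + (real p - real i) / (real p + 1) ^ 2"
    if t: "real p / (real p + 1) \<le> t" "t \<le> real p / (real p + 1) + (real i + 1) / (real p + 1) ^ 2"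
    unfolding n_def[symmetric]
  proof (rule subdiv_map_piece[OF i, of p "p + i + 1"])
    fix j assume j: "p \<le> j" "j < p + i + 1"
    have d: "subdiv p p (Suc j) - subdiv p p j = 1 / n ^ 2" using D[of j] i j by simp
    have r: "subdiv p i (Suc j) - subdiv p i j = 1 / n ^ 2" using R[of j] i j by simp
    have "subdiv p i j + (t - subdiv p p j) / (subdiv p p (Suc j) - subdiv p p j) * (subdiv p i (Suc j) - subdiv p i j)
       = real i / n + (real j - real i) / n ^ 2 + (t - (real p / n + (real j - real p) / n ^ 2))"
      unfolding d r using subdiv_source(2)[of p j, folded n_def] subdiv_target(2)[of i j p, folded n_def] i j n by simp
    also have "\<dots> = t - real p / n + real i / n + (real p - real i) / n ^ 2" using n by (simp add: field_simps)
    finally show "subdiv p i j + (t - subdiv p p j) / (subdiv p p (Suc j) - subdiv p p j) * (subdiv p i (Suc j) - subdiv p i j)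
       = t - real p / n + real i / n + (real p - real i) / n ^ 2" .
  qed (use t i in \<open>auto simp: subdiv_source add.commute\<close>)
  show "subdiv_map p i t = 1 - (real p + 1) * (1 - t)"
    if t: "real p / (real p + 1) + (real i + 1) / (real p + 1) ^ 2 \<le> t" "t \<le> 1"
    unfolding n_def[symmetric]
  proof (rule subdiv_map_piece[OF i, of "p + i + 1" "2 * p + 1"])
    fix j assume j: "p + i + 1 \<le> j" "j < 2 * p + 1"
    have d: "subdiv p p (Suc j) - subdiv p p j = 1 / n ^ 2" using D[of j] i j by simp
    have r: "subdiv p i (Suc j) - subdiv p i j = 1 / n" using R[of j] i j by simp
    have "subdiv p i j + (t - subdiv p p j) / (subdiv p p (Suc j) - subdiv p p j) * (subdiv p i (Suc j) - subdiv p i j)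
       = (real j - real p) / n + (t - (real p / n + (real j - real p) / n ^ 2)) / (1 / n ^ 2) * (1 / n)"
      unfolding d r using subdiv_source(2)[of p j, folded n_def] subdiv_target(3)[of i p j, folded n_def] i j n by simp
    also have "\<dots> = n * t - real p" using n by (simp add: field_simps power2_eq_square)
    also have "\<dots> = 1 - n * (1 - t)" by (simp add: n_def algebra_simps)
    finally show "subdiv p i j + (t - subdiv p p j) / (subdiv p p (Suc j) - subdiv p p j) * (subdiv p i (Suc j) - subdiv p i j)
       = 1 - n * (1 - t)" .
  qed (use t i subdiv_1[of p p] in \<open>auto simp: subdiv_source add.commute\<close>)
qed

lemma chart_le:
  "p \<ge> 1 \<Longrightarrow> x \<le> y \<Longrightarrow> chart p x \<le> chart p y"
  using chart_strict_mono by (simp add: strict_mono_less_eq)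

lemma gen_0_chart:
  assumes p: "p \<ge> 1"
  shows "subdiv_map p 0 (chart p y) = chart p (y - real p)"
proof -
  define n where "n = real p + 1"
  have n: "n > 0" "n \<noteq> 0" "n \<ge> 0" by (auto simp: n_def)
  note V = subdiv_map_values[of 0 p, folded n_def]
  note [simp] = n
  have c: "chart p (real p - 1) = real p / n" using chart_mid[OF p, of "real p - 1"] p by (simp add: n_def)
  have c': "chart p (real p) = real p / n + 1 / n ^ 2" using chart_right[OF p, of "real p"] p by (simp add: n_def)
  consider "y < 0" | "0 \<le> y" "y \<le> real p - 1" | "real p - 1 \<le> y" "y \<le> real p" | "real p \<le> y" by linarith
  then show ?thesis
  proof cases
    case 1
    then have "chart p y \<le> real p / n" using chart_le[OF p, of y "real p - 1"] p c by simp
    then show ?thesis using V(2)[of "chart p y"] chart_range[OF p, of y] p chart_shift_left[OF p 1]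
      by (simp add: n_def)
  next
    case 2
    then have "chart p y \<le> real p / n" using chart_le[OF p, of y "real p - 1"] c by simp
    then have "subdiv_map p 0 (chart p y) = chart p y / n"
      using V(2)[of "chart p y"] chart_range[OF p, of y] p by simp
    then show ?thesis using chart_mid[OF p 2] chart_left[OF p, of "y - real p"] 2
      by (simp add: n_def power2_eq_square)
  next
    case 3
    have y: "chart p y = real p / n + (y + 1 - real p) / n ^ 2"
      using chart_right[OF p, of y] 3 p by (simp add: n_def)
    have "(y + 1 - real p) / n ^ 2 \<le> 1 / n ^ 2" "0 \<le> (y + 1 - real p) / n ^ 2"
      using 3 by (auto intro!: divide_right_mono divide_nonneg_nonneg)
    then have "subdiv_map p 0 (chart p y) = chart p y - real p / n + real p / n ^ 2"
      using V(3)[of "chart p y"] p y by simp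
    also have "\<dots> = (y + 1) / n ^ 2" unfolding y by (simp add: diff_divide_distrib add_divide_distrib)
    finally show ?thesis using chart_left[OF p, of "y - real p"] 3 p by (simp add: n_def add.commute)
  next
    case 4
    then have "real p / n + 1 / n ^ 2 \<le> chart p y" using chart_le[OF p 4] c' by simp
    then have "subdiv_map p 0 (chart p y) = 1 - n * (1 - chart p y)"
      using V(4)[of "chart p y"] chart_range[OF p, of y] p by simp
    then show ?thesis using chart_shift_right[OF p, of "y - real p"] 4 by (simp add: n_def[symmetric])
  qed
qed

text \<open>For \<open>0 < i < p\<close> the breakpoints of \<open>x\<^sub>i\<close> are the values of the chart at \<open>i - 1\<close>, \<open>p - 1\<close> and \<open>p + i\<close>; the second of
  them is a breakpoint of the chart as well and disappears on the line.  For \<open>i = p\<close>, the scaling by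
  \<open>p + 1\<close> towards 1 in the definition of \<open>x\<^sub>p\<close> is the translation by \<open>-p\<close> in the chart, which reduces the
  claim to \<open>x\<^sub>0\<close>.\<close>

lemma gen_chart:
  assumes p: "p \<ge> 1" and i: "i \<le> p"
  shows "thompson_gen p i (chart p y) = chart p (move p (i, False) y)"
proof -
  define n where "n = real p + 1"
  have n: "n > 0" "n \<noteq> 0" "n \<ge> 0" by (auto simp: n_def)
  note [simp] = n
  note R = chart_range[OF p]
  consider "i = 0" | "1 \<le> i" "i < p" | "i = p" "1 \<le> i" using i by linarith
  then show ?thesis
  proof cases
    case 1
    then show ?thesis using p gen_0_chart[OF p] by (simp add: thompson_gen_def)
  next
    case 2
    note V = subdiv_map_values[of i p, folded n_def, OF 2(2)]
    have g: "thompson_gen p i = subdiv_map p i" and mv: "move p (i, False) y = join_at p i y"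
      using 2 by (simp_all add: thompson_gen_def)
    have ci: "chart p (real i - 1) = real i / n" using chart_mid[OF p, of "real i - 1"] 2 by (simp add: n_def)
    have cpi: "chart p (real i + real p) = real p / n + (real i + 1) / n ^ 2"
      using chart_right[OF p, of "real i + real p"] 2 by (simp add: n_def)
    have target: "chart p (real i - 1 + (y - (real i - 1)) / n) = real i / n + (y - (real i - 1)) / n ^ 2"
      if "real i - 1 \<le> y" "y \<le> real i + real p"
    proof -
      define d where "d = (y - (real i - 1)) / n"
      have "0 \<le> d" "d \<le> 1" using that by (auto simp: n_def d_def)
      moreover have "real i + 1 \<le> real p" using 2 by simp
      ultimately have "chart p (real i - 1 + d) = (1 + (real i - 1 + d)) / n"
        using 2(1) chart_mid[OF p, of "real i - 1 + d"] by (simp add: n_def)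
      then show ?thesis by (simp add: d_def add_divide_distrib power2_eq_square)
    qed
    consider "y \<le> real i - 1" | "real i - 1 \<le> y" "y \<le> real p - 1" | "real p - 1 \<le> y" "y \<le> real i + real p"
      | "real i + real p \<le> y" by linarith
    then show ?thesis
    proof cases
      case 1
      then show ?thesis using V(1)[of "chart p y"] R[of y] chart_le[OF p 1] ci
        unfolding g mv by (simp add: join_at_cases)
    next
      case a: 2
      have "chart p y = (1 + y) / n" using a 2 chart_mid[OF p, of y] by (simp add: n_def)
      moreover have "real i / n \<le> (1 + y) / n" "(1 + y) / n \<le> real p / n"
        using a by (auto intro!: divide_right_mono)
      ultimately have "subdiv_map p i (chart p y) = real i / n + ((1 + y) / n - real i / n) / n"
        using V(2)[of "chart p y"] by simp
      also have "\<dots> = real i / n + (y - (real i - 1)) / n ^ 2"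
        by (simp add: power2_eq_square diff_divide_distrib add_divide_distrib)
      finally show ?thesis using target a 2 unfolding g mv by (simp add: join_at_cases n_def)
    next
      case a: 3
      have "chart p y = real p / n + (y + 1 - real p) / n ^ 2" using a 2 chart_right[OF p, of y] by (simp add: n_def)
      moreover have "0 \<le> (y + 1 - real p) / n ^ 2" "(y + 1 - real p) / n ^ 2 \<le> (real i + 1) / n ^ 2"
        using a by (auto intro!: divide_right_mono divide_nonneg_nonneg)
      ultimately have "subdiv_map p i (chart p y) = (y + 1 - real p) / n ^ 2 + real i / n + (real p - real i) / n ^ 2"
        using V(3)[of "chart p y"] by simp
      also have "\<dots> = real i / n + (y - (real i - 1)) / n ^ 2"
        by (simp add: diff_divide_distrib add_divide_distrib)
      finally show ?thesis using target a 2 unfolding g mv by (simp add: join_at_cases n_def)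
    next
      case a: 4
      have "subdiv_map p i (chart p y) = 1 - n * (1 - chart p y)"
        using V(4)[of "chart p y"] chart_le[OF p a] cpi R[of y] by simp
      then show ?thesis using chart_shift_right[OF p, of "y - real p"] a unfolding g mv
        by (simp add: join_at_cases n_def[symmetric])
    qed
  next
    case 3
    have mv: "move p (i, False) y = join_at p p y" using 3 p by simp
    have g: "thompson_gen p i t = (if t \<le> real p / n then t else (real p + subdiv_map p 0 (n * t - real p)) / n)"
      if "0 < t" "t < 1" for t
      using 3 that by (simp add: thompson_gen_def n_def add.commute)
    have cp: "chart p (real p - 1) = real p / n" using chart_mid[OF p, of "real p - 1"] p by (simp add: n_def)
    show ?thesis
    proof (cases "y \<le> real p - 1")
      case True
      then show ?thesis using g[OF R, of y] chart_le[OF p True] cp unfolding mv by (simp add: join_at_cases)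
    next
      case False
      then have y: "real p - 1 < y" by simp
      have gt: "chart p y > real p / n"
        using strict_monoD[OF chart_strict_mono[OF p] y] cp by simp
      define t where "t = n * chart p y - real p"
      have gy: "thompson_gen p i (chart p y) = (real p + subdiv_map p 0 t) / n"
        using g[OF R, of y] gt by (simp add: t_def)
      have target: "chart p (real p - 1 + (y - (real p - 1)) / n) = real p / n + (y - (real p - 1)) / n ^ 3"
        if "y \<le> 2 * real p"
      proof -
        define d where "d = (y - (real p - 1)) / n"
        have "0 \<le> d" "d \<le> 1" using that y by (auto simp: n_def d_def)
        then have "chart p (real p - 1 + d) = real p / n + d / n ^ 2"
          using p chart_right[OF p, of "real p - 1 + d"] by (simp add: n_def)
        then show ?thesis by (simp add: d_def power2_eq_square power3_eq_cube)
      qed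
      show ?thesis
      proof (cases "y \<le> real p")
        case True
        then have "chart p y = real p / n + (y + 1 - real p) / n ^ 2"
          using chart_right[OF p, of y] y p by (simp add: n_def)
        then have t: "t = (y + 1 - real p) / n" by (simp add: t_def distrib_left power2_eq_square)
        have "0 \<le> t" "t \<le> 1 / n" using y True unfolding t by (auto intro!: divide_right_mono divide_nonneg_nonneg)
        moreover have "1 / n \<le> real p / n" using p by (intro divide_right_mono) auto
        ultimately have "subdiv_map p 0 t = t / n"
          using subdiv_map_values(2)[of 0 p t] p by (simp add: n_def)
        then have "thompson_gen p i (chart p y) = real p / n + (y - (real p - 1)) / n ^ 3"
          unfolding gy t by (simp add: add_divide_distrib diff_divide_distrib power3_eq_cube)
        then show ?thesis using target True y p unfolding mv by (simp add: join_at_cases n_def)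
      next
        case False
        have "t = chart p (y - real p)"
          using chart_shift_right[OF p, of "y - real p"] False
          by (simp add: t_def n_def[symmetric] field_simps) (simp add: n_def algebra_simps)
        then have gy': "thompson_gen p i (chart p y) = (real p + chart p (y - 2 * real p)) / n"
          using gy gen_0_chart[OF p, of "y - real p"] by (simp add: algebra_simps)
        show ?thesis
        proof (cases "y \<le> 2 * real p")
          case True
          have "chart p (y - 2 * real p) = (y - (real p - 1)) / n ^ 2"
            using chart_left[OF p, of "y - 2 * real p"] True False by (simp add: n_def algebra_simps)
          then have "thompson_gen p i (chart p y) = real p / n + (y - (real p - 1)) / n ^ 3"
            unfolding gy' by (simp add: add_divide_distrib power3_eq_cube power2_eq_square)
          then show ?thesis using target True y p unfolding mv by (simp add: join_at_cases n_def)
        next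
          case far: False
          have "(real p + chart p (y - 2 * real p)) / n = chart p (y - real p)"
            using chart_shift_right[OF p, of "y - 2 * real p"] far
            by (simp add: n_def[symmetric] field_simps) (simp add: n_def algebra_simps)
          then show ?thesis using gy' far unfolding mv by (simp add: join_at_cases)
        qed
      qed
    qed
  qed
qed

section \<open>Words in the group\<close>

lemma run_surj:
  assumes "p \<ge> 1"
  shows "\<exists>y. run p hs y = z"
proof (induction hs)
  case (Cons a hs)
  then obtain y where "run p hs y = z" by blast
  moreover have "move p a (move p (inv_letter a) y) = y"
    using move_inv[OF assms, of "inv_letter a" y] by (cases a) (auto simp del: move.simps)
  ultimately have "run p (a # hs) (move p (inv_letter a) y) = z" by simp
  then show ?case by blast
qed auto

text \<open>Otherwise the simplifier turns \<open>p + 1\<close> in \<open>thompson_F (p + 1)\<close> into a successor.\<close>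

declare One_nat_def [simp del]

definition letter_elem :: "nat \<Rightarrow> letter \<Rightarrow> real \<Rightarrow> real" where
  "letter_elem p a = (if snd a then thompson_gen p (fst a) else inv\<^bsub>thompson_F (p + 1)\<^esub> thompson_gen p (fst a))"

definition word_elem :: "nat \<Rightarrow> letter list \<Rightarrow> real \<Rightarrow> real" where
  "word_elem p hs = foldr (mult (thompson_F (p + 1))) (map (letter_elem p) hs) (one (thompson_F (p + 1)))"

lemma carrier_thompson_F: "carrier (thompson_F n) = thompson_carrier n"
  by (simp add: thompson_F_def)

lemma mult_thompson_F:
  assumes "f \<in> thompson_carrier n" "g \<in> thompson_carrier n" "t \<in> {0..1}"
  shows "(f \<otimes>\<^bsub>thompson_F n\<^esub> g) t = f (g t)"
  using assms thompson_carrierD(8) by (simp add: thompson_F_def BijGroup_def compose_def)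

lemma letter_elem_carrier: "p \<ge> 1 \<Longrightarrow> letter_elem p a \<in> carrier (thompson_F (p + 1))"
  using group.inv_closed[OF group_thompson_F] thompson_gen_in_carrier
  by (auto simp: letter_elem_def carrier_thompson_F)

lemma word_elem_carrier:
  assumes p: "p \<ge> 1"
  shows "word_elem p hs \<in> carrier (thompson_F (p + 1))"
proof -
  interpret group "thompson_F (p + 1)" by (rule group_thompson_F) simp
  show ?thesis
  proof (induction hs)
    case (Cons a hs)
    then show ?case using letter_elem_carrier[OF p, of a] by (simp add: word_elem_def)
  qed (simp add: word_elem_def)
qed

lemma word_elem_append:
  assumes p: "p \<ge> 1"
  shows "word_elem p (hs @ hs') = word_elem p hs \<otimes>\<^bsub>thompson_F (p + 1)\<^esub> word_elem p hs'"
proof -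
  interpret group "thompson_F (p + 1)" by (rule group_thompson_F) simp
  note C = word_elem_carrier[OF p] letter_elem_carrier[OF p]
  show ?thesis
  proof (induction hs)
    case Nil
    then show ?case using C(1)[of hs'] by (simp add: word_elem_def)
  next
    case (Cons a hs)
    have "word_elem p ((a # hs) @ hs') = letter_elem p a \<otimes>\<^bsub>thompson_F (p + 1)\<^esub> word_elem p (hs @ hs')"
      by (simp add: word_elem_def)
    also have "\<dots> = (letter_elem p a \<otimes>\<^bsub>thompson_F (p + 1)\<^esub> word_elem p hs) \<otimes>\<^bsub>thompson_F (p + 1)\<^esub> word_elem p hs'"
      unfolding Cons using C by (simp only: m_assoc)
    finally show ?case by (simp add: word_elem_def)
  qed
qed

lemma word_elem_single: "p \<ge> 1 \<Longrightarrow> word_elem p [a] = letter_elem p a"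
proof -
  assume p: "p \<ge> 1"
  interpret group "thompson_F (p + 1)" by (rule group_thompson_F) simp
  show ?thesis using letter_elem_carrier[OF p, of a] by (simp add: word_elem_def)
qed

lemma word_elem_power:
  assumes p: "p \<ge> 1"
  shows "word_elem p (power_word l) = thompson_gen p 0 [^]\<^bsub>thompson_F (p + 1)\<^esub> l"
proof -
  interpret group "thompson_F (p + 1)" by (rule group_thompson_F) simp
  have g: "thompson_gen p 0 \<in> carrier (thompson_F (p + 1))"
    using thompson_gen_in_carrier[OF p] by (simp add: carrier_thompson_F)
  have R: "word_elem p (replicate k (0, up)) = letter_elem p (0, up) [^]\<^bsub>thompson_F (p + 1)\<^esub> k" for k up
  proof (induction k)
    case 0
    then show ?case by (simp add: word_elem_def)
  next
    case (Suc k)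
    have "replicate (Suc k) (0::nat, up) = replicate k (0, up) @ [(0, up)]" by (simp add: replicate_append_same)
    then show ?case using Suc word_elem_append[OF p] word_elem_single[OF p] by simp
  qed
  show ?thesis
  proof (cases "l \<ge> 0")
    case True
    then have "word_elem p (power_word l) = letter_elem p (0, True) [^]\<^bsub>thompson_F (p + 1)\<^esub> nat l"
      by (simp only: power_word_def R if_True)
    then show ?thesis using True
      by (simp only: int_pow_def2 letter_elem_def not_less[symmetric] if_False if_True fst_conv snd_conv)
  next
    case False
    then have "word_elem p (power_word l) = letter_elem p (0, False) [^]\<^bsub>thompson_F (p + 1)\<^esub> nat (- l)"
      by (simp only: power_word_def R if_False)
    then show ?thesis using False
      by (simp only: int_pow_def2 letter_elem_def not_le if_False if_True fst_conv snd_conv nat_pow_inv[OF g])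
  qed
qed

lemma letter_elem_chart:
  assumes p: "p \<ge> 1" and a: "fst a \<le> p"
  shows "letter_elem p a (chart p (move p a y)) = chart p y"
proof -
  interpret group "thompson_F (p + 1)" by (rule group_thompson_F) simp
  obtain i up where i: "a = (i, up)" by (cases a)
  have g: "thompson_gen p i (chart p z) = chart p (move p (i, False) z)" for z
    using gen_chart[OF p] a by (simp add: i)
  have G: "thompson_gen p i \<in> thompson_carrier (p + 1)" using thompson_gen_in_carrier[OF p] .
  show ?thesis
  proof (cases up)
    case True
    then show ?thesis using g move_inv[OF p, of a y] by (simp add: i letter_elem_def)
  next
    case False
    let ?h = "inv\<^bsub>thompson_F (p + 1)\<^esub> thompson_gen p i"
    have H: "?h \<in> thompson_carrier (p + 1)" using inv_closed G by (simp add: carrier_thompson_F)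
    have c: "chart p z \<in> {0..1}" for z using chart_range[OF p, of z] by simp
    have "?h \<otimes>\<^bsub>thompson_F (p + 1)\<^esub> thompson_gen p i = \<one>\<^bsub>thompson_F (p + 1)\<^esub>"
      using G by (simp add: carrier_thompson_F)
    then have "?h (thompson_gen p i (chart p y)) = \<one>\<^bsub>thompson_F (p + 1)\<^esub> (chart p y)"
      using mult_thompson_F[OF H G c, of y] by simp
    also have "\<dots> = chart p y" using c[of y] by (simp add: thompson_F_def BijGroup_def)
    finally show ?thesis using g False by (simp add: i letter_elem_def)
  qed
qed

text \<open>In the chart, \<open>run p hs\<close> is the inverse of \<open>word_elem p hs\<close>.\<close>

lemma word_elem_chart:
  assumes p: "p \<ge> 1" and v: "\<forall>h\<in>set hs. fst h \<le> p"
  shows "word_elem p hs (chart p (run p hs y)) = chart p y"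
  using v
proof (induction hs arbitrary: y)
  case Nil
  then show ?case using chart_range[OF p, of y]
    by (simp add: word_elem_def thompson_F_def BijGroup_def)
next
  case (Cons a hs)
  have c: "chart p z \<in> {0..1}" for z using chart_range[OF p, of z] by simp
  have "word_elem p (a # hs) = letter_elem p a \<otimes>\<^bsub>thompson_F (p + 1)\<^esub> word_elem p hs"
    by (simp add: word_elem_def)
  then have "word_elem p (a # hs) (chart p (run p (a # hs) y)) =
      letter_elem p a (word_elem p hs (chart p (run p hs (move p a y))))"
    using mult_thompson_F[of "letter_elem p a" "p + 1" "word_elem p hs"] c
      letter_elem_carrier[OF p, of a] word_elem_carrier[OF p, of hs] by (simp add: carrier_thompson_F)
  then show ?case using Cons letter_elem_chart[OF p, of a y] by simp
qed

text \<open>The chart is injective and reaches every point other than 0 and 1, which all elements of the group fix.\<close>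

lemma word_elem_eq_iff:
  assumes p: "p \<ge> 1" and v: "\<forall>h\<in>set hs. fst h \<le> p" "\<forall>h\<in>set hs'. fst h \<le> p"
  shows "word_elem p hs = word_elem p hs' \<longleftrightarrow> run p hs = run p hs'"
proof
  have c: "chart p z \<in> {0..1}" for z using chart_range[OF p, of z] by simp
  have C: "word_elem p hs \<in> thompson_carrier (p + 1)" for hs
    using word_elem_carrier[OF p] by (simp add: carrier_thompson_F)
  show "run p hs = run p hs'" if eq: "word_elem p hs = word_elem p hs'"
  proof
    fix y
    have "word_elem p hs (chart p (run p hs y)) = word_elem p hs (chart p (run p hs' y))"
      using word_elem_chart[OF p v(1), of y] word_elem_chart[OF p v(2), of y] eq by simp
    moreover have "inj_on (word_elem p hs) {0..1}"
      using thompson_carrierD(2)[OF C] by (simp add: bij_betw_def)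
    ultimately have "chart p (run p hs y) = chart p (run p hs' y)"
      using c by (auto dest: inj_onD)
    then show "run p hs y = run p hs' y"
      using strict_mono_eq[OF chart_strict_mono[OF p]] by simp
  qed
  show "word_elem p hs = word_elem p hs'" if eq: "run p hs = run p hs'"
  proof (rule extensionalityI[of _ "{0..1}"])
    fix t :: real assume t: "t \<in> {0..1}"
    show "word_elem p hs t = word_elem p hs' t"
    proof (cases "t = 0 \<or> t = 1")
      case True
      then show ?thesis using thompson_carrierD(5,6)[OF C] by auto
    next
      case False
      then obtain z where z: "chart p z = t" using chart_surj[OF p, of t] t by auto
      obtain y where "run p hs y = z" using run_surj[OF p] by blast
      then show ?thesis
        using word_elem_chart[OF p v(1), of y] word_elem_chart[OF p v(2), of y] eq z by simp
    qed
  qed (use thompson_carrierD(1)[OF C] in auto)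
qed

lemma letters_of_gens:
  assumes "set es \<subseteq> thompson_gens p \<union> m_inv (thompson_F (p + 1)) ` thompson_gens p"
  obtains hs where "\<forall>h\<in>set hs. fst h \<le> p" "map (letter_elem p) hs = es"
proof -
  have "\<exists>hs. (\<forall>h\<in>set hs. fst h \<le> p) \<and> map (letter_elem p) hs = es"
    using assms
  proof (induction es)
    case (Cons e es)
    then obtain hs where hs: "\<forall>h\<in>set hs. fst h \<le> p" "map (letter_elem p) hs = es" by auto
    have "e \<in> thompson_gens p \<or> e \<in> m_inv (thompson_F (p + 1)) ` thompson_gens p"
      using Cons.prems by auto
    then obtain i up where i: "i \<le> p" "e = letter_elem p (i, up)"
    proof
      assume "e \<in> thompson_gens p"
      then show thesis using that[of _ True] by (auto simp: thompson_gens_def letter_elem_def)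
    next
      assume "e \<in> m_inv (thompson_F (p + 1)) ` thompson_gens p"
      then show thesis using that[of _ False] by (auto simp: thompson_gens_def letter_elem_def)
    qed
    show ?case using hs i by (intro exI[of _ "(i, up) # hs"]) auto
  qed simp
  then show ?thesis using that by blast
qed

lemma letter_elem_gens:
  "fst a \<le> p \<Longrightarrow> letter_elem p a \<in> thompson_gens p \<union> m_inv (thompson_F (p + 1)) ` thompson_gens p"
  by (auto simp: letter_elem_def thompson_gens_def)

lemma word_length_bounds:
  assumes p: "p \<ge> 1" and v: "\<forall>h\<in>set W. fst h \<le> p"
  shows "word_length (thompson_F (p + 1)) (thompson_gens p) (word_elem p W) \<le> length W"
    and "(\<And>hs. \<forall>h\<in>set hs. fst h \<le> p \<Longrightarrow> run p hs = run p W \<Longrightarrow> B \<le> length hs) \<Longrightarrow>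
      B \<le> word_length (thompson_F (p + 1)) (thompson_gens p) (word_elem p W)"
proof -
  let ?G = "thompson_F (p + 1)"
  define Q where "Q n \<longleftrightarrow> (\<exists>hs. set hs \<subseteq> thompson_gens p \<union> m_inv ?G ` thompson_gens p \<and> length hs = n \<and>
    foldr (mult ?G) hs (one ?G) = word_elem p W)" for n
  have wl: "word_length ?G (thompson_gens p) (word_elem p W) = (LEAST n. Q n)"
    by (simp add: word_length_def Q_def)
  have Q: "Q (length W)" unfolding Q_def
    using v letter_elem_gens by (intro exI[of _ "map (letter_elem p) W"]) (force simp: word_elem_def)
  then show "word_length ?G (thompson_gens p) (word_elem p W) \<le> length W"
    unfolding wl by (rule Least_le)
  assume B: "\<And>hs. \<forall>h\<in>set hs. fst h \<le> p \<Longrightarrow> run p hs = run p W \<Longrightarrow> B \<le> length hs"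
  have "Q (LEAST n. Q n)" using Q by (rule LeastI)
  then obtain es where es: "set es \<subseteq> thompson_gens p \<union> m_inv ?G ` thompson_gens p"
    "length es = (LEAST n. Q n)" "foldr (mult ?G) es (one ?G) = word_elem p W"
    unfolding Q_def by blast
  obtain hs where hs: "\<forall>h\<in>set hs. fst h \<le> p" "map (letter_elem p) hs = es"
    using letters_of_gens[OF es(1)] .
  then have "word_elem p hs = word_elem p W" using es(3) by (simp add: word_elem_def)
  then have "B \<le> length hs" using B hs word_elem_eq_iff[OF p hs(1) v] by simp
  then show "B \<le> word_length ?G (thompson_gens p) (word_elem p W)"
    unfolding wl es(2)[symmetric] hs(2)[symmetric] by simp
qed

text \<open>Cancel \<open>x\<^sub>0\<^sup>l\<close> against the end of the word that does the left job last if \<open>l \<ge> 0\<close>, and against the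
  end of the other word if \<open>l < 0\<close>.\<close>

lemma short_word:
  assumes p: "p \<ge> 1" and m: "m \<ge> 1" and l: "\<bar>l\<bar> \<le> int m"
  shows "\<exists>hs. (\<forall>h\<in>set hs. fst h \<le> p) \<and> run p hs = run p (visit_word m @ comb_word m @ power_word l) \<and>
    int (length hs) = 5 * int m + 3 - \<bar>l\<bar>"
proof (cases "l \<ge> 0")
  case True
  define k where "k = nat l"
  have k: "l = int k" "k \<le> m" using True l by (auto simp: k_def)
  define hs where "hs = comb_word m @ replicate m (0, True) @ [(1, True)] @ replicate (Suc m - k) (0, False)"
  have "run p hs t = run p (visit_word m @ comb_word m @ power_word l) t" for t
  proof -
    have "run p (visit_word m @ comb_word m @ power_word l) t =
      run p (comb_word m @ visit_word m) t + real p * of_int l"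
      using words_commute[OF m p] by (metis append.assoc run_append run_power)
    then show ?thesis using k
      by (simp add: hs_def visit_word_def run_append run_rights run_lefts of_nat_diff algebra_simps del: replicate.simps)
  qed
  moreover have "int (length hs) = 5 * int m + 3 - \<bar>l\<bar>"
    using k by (simp add: hs_def comb_word_def length_concat sum_list_replicate of_nat_diff)
  moreover have "\<forall>h\<in>set hs. fst h \<le> p" using p by (auto simp: hs_def comb_word_def)
  ultimately show ?thesis by blast
next
  case False
  define k where "k = nat (- l)"
  have k: "l = - int k" "k \<le> m" using False l by (auto simp: k_def)
  define hs where "hs = visit_word m @ concat (replicate m [(1, True), (0, False)]) @ [(1, True)] @ replicate (m - k) (0, True)"
  have "run p hs t = run p (visit_word m @ comb_word m @ power_word l) t" for t
    using k by (simp add: hs_def comb_word_def run_append run_rights run_power of_nat_diff algebra_simps)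
  moreover have "int (length hs) = 5 * int m + 3 - \<bar>l\<bar>"
    using k by (simp add: hs_def visit_word_def length_concat sum_list_replicate of_nat_diff)
  moreover have "\<forall>h\<in>set hs. fst h \<le> p" using p by (auto simp: hs_def visit_word_def)
  ultimately show ?thesis by blast
qed

section \<open>Seesaw words of large swing\<close>

text \<open>The choice \<open>m = K + 3\<close> leaves room for swing \<open>K + 1\<close>: the exponents \<open>|l| \<le> K\<close> that are followed by another
  letter satisfy \<open>|l| \<le> m - 2\<close>, and those with \<open>|l| \<le> K + 1\<close> satisfy \<open>|l| \<le> m\<close>.\<close>

theorem corollary2p1:
  fixes p :: nat
  assumes "p \<ge> 1"
  shows "\<forall>K::nat. \<exists>k\<ge>K. \<exists>w \<in> carrier (thompson_F (p + 1)).
           seesaw_word (thompson_F (p + 1)) (thompson_gens p) (thompson_gen p 0) k w"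
proof
  fix K :: nat
  let ?G = "thompson_F (p + 1)" and ?X = "thompson_gens p" and ?g = "thompson_gen p 0"
  interpret group ?G by (rule group_thompson_F) simp
  define m where "m = K + 3"
  define w where "w = word_elem p (visit_word m @ comb_word m)"
  have w: "w \<in> carrier ?G" unfolding w_def by (rule word_elem_carrier[OF assms])
  have g: "?g \<in> ?X" by (simp add: thompson_gens_def)
  have valid: "\<forall>h\<in>set (visit_word m @ comb_word m @ power_word l). fst h \<le> p" for l
    using assms by (auto simp: visit_word_def comb_word_def power_word_def)
  have wg: "w \<otimes>\<^bsub>?G\<^esub> (?g [^]\<^bsub>?G\<^esub> l) = word_elem p (visit_word m @ comb_word m @ power_word l)" for l :: int
    using word_elem_append[OF assms, of "visit_word m @ comb_word m" "power_word l"]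
    by (simp add: w_def word_elem_power[OF assms])
  have len: "int (word_length ?G ?X (w \<otimes>\<^bsub>?G\<^esub> (?g [^]\<^bsub>?G\<^esub> l))) = 5 * int m + 3 - \<bar>l\<bar>"
    if l: "\<bar>l\<bar> \<le> int m" for l :: int
  proof -
    obtain hs where hs: "\<forall>h\<in>set hs. fst h \<le> p"
      "run p hs = run p (visit_word m @ comb_word m @ power_word l)" "int (length hs) = 5 * int m + 3 - \<bar>l\<bar>"
      using short_word[OF assms _ l] by (auto simp: m_def)
    have e: "w \<otimes>\<^bsub>?G\<^esub> (?g [^]\<^bsub>?G\<^esub> l) = word_elem p hs"
      by (rule trans[OF wg sym[OF iffD2[OF word_elem_eq_iff[OF assms hs(1) valid] hs(2)]]])
    have "length hs \<le> word_length ?G ?X (word_elem p hs)"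
    proof (rule word_length_bounds(2)[OF assms hs(1)])
      fix hs' assume "\<forall>h\<in>set hs'. fst h \<le> p" "run p hs' = run p hs"
      then have "int (length hs') \<ge> 5 * int m + 3 - \<bar>l\<bar>"
        using seesaw_lower_bound[OF assms, of m hs' "[]" l] hs(2) l by (simp add: m_def)
      then show "length hs \<le> length hs'" using hs(3) by linarith
    qed
    then show ?thesis using word_length_bounds(1)[OF assms hs(1)] hs(3) unfolding e by linarith
  qed
  have w0: "w \<otimes>\<^bsub>?G\<^esub> (?g [^]\<^bsub>?G\<^esub> (0::int)) = w" using w by simp
  have "seesaw_word ?G ?X ?g (K + 1) w"
    unfolding seesaw_word_def
  proof (intro conjI allI ballI impI)
    show "?g \<in> ?X" "w \<in> carrier ?G" by (rule g, rule w)
    show "1 \<le> K + 1" by simp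
  next
    fix l :: int assume l: "0 < \<bar>l\<bar> \<and> \<bar>l\<bar> \<le> int (K + 1)"
    then show "int (word_length ?G ?X (w \<otimes>\<^bsub>?G\<^esub> (?g [^]\<^bsub>?G\<^esub> l))) = int (word_length ?G ?X w) - \<bar>l\<bar>"
      using len[of l] len[of 0] unfolding w0 by (simp add: m_def)
  next
    fix h and l :: int
    assume h: "h \<in> ?X \<union> m_inv ?G ` ?X" "h \<noteq> ?g \<and> h \<noteq> inv\<^bsub>?G\<^esub> ?g" and l: "\<bar>l\<bar> < int (K + 1)"
    obtain as where as: "\<forall>a\<in>set as. fst a \<le> p" "map (letter_elem p) as = [h]"
      using letters_of_gens[of "[h]" p] h(1) by (metis empty_set empty_subsetI insert_subset list.simps(15))
    then obtain a where a: "fst a \<le> p" "h = letter_elem p a" by (cases as) auto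
    have a1: "fst a \<noteq> 0"
    proof
      assume "fst a = 0"
      then show False using h(2) a(2) by (cases "snd a") (simp_all add: letter_elem_def)
    qed
    let ?W = "visit_word m @ comb_word m @ power_word l @ [a]"
    have W: "\<forall>h\<in>set ?W. fst h \<le> p" using valid[of l] a(1) by auto
    have e: "w \<otimes>\<^bsub>?G\<^esub> (?g [^]\<^bsub>?G\<^esub> l) \<otimes>\<^bsub>?G\<^esub> h = word_elem p ?W"
      using word_elem_append[OF assms, of "visit_word m @ comb_word m @ power_word l" "[a]"]
        word_elem_single[OF assms] wg a(2) by simp
    have "word_length ?G ?X (w \<otimes>\<^bsub>?G\<^esub> (?g [^]\<^bsub>?G\<^esub> l)) \<le> word_length ?G ?X (word_elem p ?W)"
    proof (rule word_length_bounds(2)[OF assms W])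
      fix hs' assume hs': "\<forall>h\<in>set hs'. fst h \<le> p" "run p hs' = run p ?W"
      have "\<exists>i up. [a] = [(i, up)] \<and> 1 \<le> i \<and> i \<le> p \<and> \<bar>l\<bar> \<le> int m - 2"
        using a a1 l by (cases a) (auto simp: m_def)
      then have "int (length hs') \<ge> 5 * int m + 3 - \<bar>l\<bar>"
        using seesaw_lower_bound[OF assms _ hs'(1), of m "[a]" l] hs'(2) by (simp add: m_def)
      then show "word_length ?G ?X (w \<otimes>\<^bsub>?G\<^esub> (?g [^]\<^bsub>?G\<^esub> l)) \<le> length hs'"
        using len[of l] l by (simp add: m_def)
    qed
    then show "word_length ?G ?X (w \<otimes>\<^bsub>?G\<^esub> (?g [^]\<^bsub>?G\<^esub> l)) \<le>
      word_length ?G ?X (w \<otimes>\<^bsub>?G\<^esub> (?g [^]\<^bsub>?G\<^esub> l) \<otimes>\<^bsub>?G\<^esub> h)"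
      unfolding e .
  qed
  then show "\<exists>k\<ge>K. \<exists>w\<in>carrier ?G. seesaw_word ?G ?X ?g k w"
    using w by (intro exI[of _ "K + 1"] conjI bexI[of _ w]) simp_all
qed

end
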